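(* Let $\varphi:\mathcal C_2\to\mathcal C_2$ be the homeomorphism represented by the binary transducer $T^\varphi$ given in the context, let $H_i=F^{\varphi^i}$, and let $\mathcal A_i$ ($i\ge0$) be the finite binary tree-automata defined in the context. For every $i\ge0$, the core of $H_i$ is isomorphic to $\mathcal A_i$: $\mathcal C(H_i)\cong\mathcal A_i$.
   Context: $\mathcal C_2=\{0,1\}^{\mathbb N}$ with the lexicographic order. Thompson's group $F$ is the group of order-preserving homeomorphisms $f$ of $\mathcal C_2$ for which there are finite complete prefix codes $\{u_1<\dots<u_k\}$, $\{v_1<\dots<v_k\}$ of binary words (complete: cylinders partition $\mathcal C_2$) with $f(u_i\omega)=v_i\omega$. Such a pair is a tree diagram $(T_+,T_-)$: $T_+$, $T_-$ are the finite full binary trees with leaf sets $\{u_i\}$, $\{v_i\}$. Each $f$ has a unique reduced tree diagram (one where no $j$ and words $u,v$ satisfy $u_j=u0,u_{j+1}=u1,v_j=v0,v_{j+1}=v1$). A binary tree-automaton is a rooted deterministic automaton over $\{0,1\}$ in which every state is reachable from the root and every state has either no outgoing transitions or exactly one for each of $0,1$ (in the latter case it is a father state). It is folded if no two distinct father states have the same ordered pair of children. Isomorphisms preserve the root and labelled edges. Core: for $H\le F$ generated by a set $S$, take for each $s\in S$ its reduced tree diagram, view both trees as rooted graphs with edges directed away from the root and labelled $0$ (left), $1$ (right), identify the two roots and identify the $i$-th leaf of $T_+$ with the $i$-th leaf of $T_-$ for each $i$; then identify the roots over all $s\in S$. Take the quotient by the smallest equivalence relation on vertices (identifying correspondingly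 labelled edges) such that (a) each vertex has at most one outgoing edge with each label, and (b) no two distinct father states have the same ordered pair of children. The resulting folded tree-automaton is the core $\mathcal C(H)$; it does not depend on $S$. $T^\varphi$ has states $\mathsf L,\mathsf R,\mathsf A,\mathsf B$, initial state $\mathsf L$; $i\mid w\to s'$ in the row of $s$ means: in state $s$ on input $i$, output $w$ and move to $s'$. $\mathsf L$: $0\mid0\to\mathsf L$, $1\mid1\to\mathsf R$; $\mathsf R$: $0\mid0\to\mathsf A$, $1\mid1\to\mathsf R$; $\mathsf A$: $0\mid00\to\mathsf A$, $1\mid\varepsilon\to\mathsf B$; $\mathsf B$: $0\mid01\to\mathsf A$, $1\mid1\to\mathsf R$. $\varphi$ is the represented order-preserving homeomorphism, $F^{\varphi^i}=\{\varphi^i\circ f\circ\varphi^{-i}:f\in F\}$, and $F^{\varphi^i}\le F$. Automata $\mathcal A_i$ ($q\cdot b$ denotes the $b$-child; root $\rho$). $\mathcal A_0$ has states $\rho,\ell,r,c$ with $\rho\cdot0=\ell,\ \rho\cdot1=r,\ \ell\cdot0=\ell,\ \ell\cdot1=c,\ r\cdot0=c,\ r\cdot1=r,\ c\cdot0=c\cdot1=c$. For $i\ge1$, $\mathcal A_i$ has states $\rho,\ell,r,c,a_0,\dots,a_{2^i-1}$ with $\rho\cdot0=\ell,\ \rho\cdot1=r,\ \ell\cdot0=\ell,\ \ell\cdot1=c,\ r\cdot0=a_0,\ r\cdot1=r,\ c\cdot0=a_0,\ c\cdot1=c$, and for $0\le t<2^i$: $a_t\cdot0=a_{t+1 \bmod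 2^i}$, $a_t\cdot1=c$ if $t$ is even, and $a_t\cdot1=a_{k(t)}$ if $t$ is odd, where $k(t)=2^{\nu_2(t+1)}-2$ and $\nu_2$ is the $2$-adic valuation. *)

theory Defs
  imports
    "HOL-Analysis.Function_Topology"
    "HOL-Algebra.Generated_Groups"
    "HOL-Computational_Algebra.Primes"
    "HOL-Library.Fun_Lexorder"
    "HOL-Library.List_Lexorder"
    "HOL-Library.Omega_Words_Fun"
    "HOL-Library.Sublist"
begin

text \<open>
  The digits 0 and 1 are \<^const>\<open>False\<close> and \<^const>\<open>True\<close>; their order and discrete topology are the
  library instances for \<^typ>\<open>bool\<close>.  The Cantor space is the type \<^typ>\<open>bool word\<close>, i.e.
  \<^typ>\<open>nat \<Rightarrow> bool\<close> with the product topology.  Its lexicographic order is \<^const>\<open>less_fun\<close>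
  (the operator \<open><\<close> on functions is the pointwise order and is not used on it), whereas \<open><\<close> on
  finite words, of type \<^typ>\<open>bool list\<close>, is lexicographic.
\<close>

section \<open>Thompson's group F\<close>

definition cylinder :: "bool list \<Rightarrow> bool word set" where
  "cylinder u = {u \<frown> x | x. True}"

definition complete_prefix_code :: "bool list set \<Rightarrow> bool" where
  "complete_prefix_code U \<longleftrightarrow>
     finite U \<and>
     (\<forall>u\<in>U. \<forall>v\<in>U. Sublist.prefix u v \<longrightarrow> u = v) \<and>
     (\<Union>u\<in>U. cylinder u) = UNIV"

text \<open>
  A tree diagram is given by the increasing lists of the leaves of its two trees.
\<close>

definition tree_diagram :: "bool list list \<Rightarrow> bool list list \<Rightarrow> bool" where
  "tree_diagram us vs \<longleftrightarrow>
     length us = length vs \<and>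
     sorted_wrt (<) us \<and> sorted_wrt (<) vs \<and>
     complete_prefix_code (set us) \<and> complete_prefix_code (set vs)"

definition represents ::
    "bool list list \<Rightarrow> bool list list \<Rightarrow> (bool word \<Rightarrow> bool word) \<Rightarrow> bool" where
  "represents us vs f \<longleftrightarrow> (\<forall>i<length us. \<forall>x. f (us ! i \<frown> x) = vs ! i \<frown> x)"

definition reduced :: "bool list list \<Rightarrow> bool list list \<Rightarrow> bool" where
  "reduced us vs \<longleftrightarrow>
     \<not> (\<exists>j u v. Suc j < length us \<and>
          us ! j = u @ [False] \<and> us ! Suc j = u @ [True] \<and>
          vs ! j = v @ [False] \<and> vs ! Suc j = v @ [True])"

definition reduced_tree_diagram ::
    "(bool word \<Rightarrow> bool word) \<Rightarrow> bool list list \<Rightarrow> bool list list \<Rightarrow> bool" where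
  "reduced_tree_diagram f us vs \<longleftrightarrow> tree_diagram us vs \<and> represents us vs f \<and> reduced us vs"

definition order_preserving :: "(bool word \<Rightarrow> bool word) \<Rightarrow> bool" where
  "order_preserving f \<longleftrightarrow> (\<forall>x y. less_fun x y \<longrightarrow> less_fun (f x) (f y))"

definition thompson_F :: "(bool word \<Rightarrow> bool word) monoid" where
  "thompson_F =
     \<lparr> carrier = {f. (\<exists>g. homeomorphism UNIV UNIV f g) \<and> order_preserving f \<and>
                    (\<exists>us vs. tree_diagram us vs \<and> represents us vs f)},
       monoid.mult = (\<lambda>f g. f \<circ> g),
       one = id \<rparr>"

section \<open>Rooted automata over the binary alphabet\<close>

record 'v automaton =
  states :: "'v set"
  root_state :: 'v
  edges :: "('v \<times> bool \<times> 'v) set"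

definition deterministic :: "'v automaton \<Rightarrow> bool" where
  "deterministic G \<longleftrightarrow>
     (\<forall>p b q q'. (p, b, q) \<in> edges G \<longrightarrow> (p, b, q') \<in> edges G \<longrightarrow> q = q')"

definition folded :: "'v automaton \<Rightarrow> bool" where
  "folded G \<longleftrightarrow>
     (\<forall>p q c d. (p, False, c) \<in> edges G \<longrightarrow> (p, True, d) \<in> edges G \<longrightarrow>
                (q, False, c) \<in> edges G \<longrightarrow> (q, True, d) \<in> edges G \<longrightarrow> p = q)"

definition quotient_automaton :: "'v automaton \<Rightarrow> ('v \<times> 'v) set \<Rightarrow> 'v set automaton" where
  "quotient_automaton G E =
     \<lparr> states = states G // E,
       root_state = E `` {root_state G},
       edges = {(E `` {p}, b, E `` {q}) | p b q. (p, b, q) \<in> edges G} \<rparr>"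

text \<open>
  The admissible relations are closed under intersection, so this is the smallest one.
\<close>

definition folding_relation :: "'v automaton \<Rightarrow> ('v \<times> 'v) set \<Rightarrow> ('v \<times> 'v) set" where
  "folding_relation G R =
     \<Inter> {E. equiv (states G) E \<and> R \<subseteq> E \<and>
           deterministic (quotient_automaton G E) \<and> folded (quotient_automaton G E)}"

definition automaton_isomorphic :: "'v automaton \<Rightarrow> 'w automaton \<Rightarrow> bool" where
  "automaton_isomorphic G K \<longleftrightarrow>
     (\<exists>h. bij_betw h (states G) (states K) \<and>
          h (root_state G) = root_state K \<and>
          (\<forall>p\<in>states G. \<forall>q\<in>states G. \<forall>b.
             (p, b, q) \<in> edges G \<longleftrightarrow> (h p, b, h q) \<in> edges K))"

section \<open>The core\<close>

datatype side = T_plus | T_minus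

text \<open>
  The vertices of a finite full binary tree are the prefixes of its leaves.  The vertex \<open>w\<close> of the
  tree \<open>T\<^sub>+\<close> or \<open>T\<^sub>-\<close> of \<open>s\<close> is \<open>vertex s \<sigma> w\<close>; all tree roots (the empty words) are the
  same vertex from the start.  \<open>Node\<close> is only used with a nonempty word.
\<close>

datatype vertex = Root | Node "bool word \<Rightarrow> bool word" side "bool list"

definition vertex :: "(bool word \<Rightarrow> bool word) \<Rightarrow> side \<Rightarrow> bool list \<Rightarrow> vertex" where
  "vertex s \<sigma> w = (if w = [] then Root else Node s \<sigma> w)"

definition tree_words :: "(bool word \<Rightarrow> bool word) \<Rightarrow> side \<Rightarrow> bool list set" where
  "tree_words s \<sigma> =
     {w. \<exists>us vs. reduced_tree_diagram s us vs \<and>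
           (\<exists>u \<in> set (case \<sigma> of T_plus \<Rightarrow> us | T_minus \<Rightarrow> vs). Sublist.prefix w u)}"

definition tree_graph :: "(bool word \<Rightarrow> bool word) set \<Rightarrow> vertex automaton" where
  "tree_graph S =
     \<lparr> states = insert Root {vertex s \<sigma> w | s \<sigma> w. s \<in> S \<and> w \<in> tree_words s \<sigma>},
       root_state = Root,
       edges = {(vertex s \<sigma> w, b, vertex s \<sigma> (w @ [b])) | s \<sigma> w b.
                  s \<in> S \<and> w @ [b] \<in> tree_words s \<sigma>} \<rparr>"

definition leaf_gluing :: "(bool word \<Rightarrow> bool word) set \<Rightarrow> (vertex \<times> vertex) set" where
  "leaf_gluing S =
     {(vertex s T_plus (us ! i), vertex s T_minus (vs ! i)) | s us vs i.
        s \<in> S \<and> reduced_tree_diagram s us vs \<and> i < length us}"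

text \<open>
  Identifying the leaves and then passing to the folded quotient is a single quotient, by the
  smallest relation that contains the leaf identifications.  As a function of the generating set
  \<open>S\<close>, this is the core of the subgroup of F generated by \<open>S\<close>.
\<close>

definition core :: "(bool word \<Rightarrow> bool word) set \<Rightarrow> vertex set automaton" where
  "core S = quotient_automaton (tree_graph S) (folding_relation (tree_graph S) (leaf_gluing S))"

section \<open>The transducer and its homeomorphism\<close>

fun transducer_output :: "('s \<Rightarrow> bool \<Rightarrow> bool list \<times> 's) \<Rightarrow> 's \<Rightarrow> bool list \<Rightarrow> bool list" where
  "transducer_output T q [] = []"
| "transducer_output T q (b # w) = fst (T q b) @ transducer_output T (snd (T q b)) w"

text \<open>
  The image of \<open>x\<close> is the sequence that starts with the outputs on all finite prefixes of \<open>x\<close>.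
\<close>

definition transducer_map :: "('s \<Rightarrow> bool \<Rightarrow> bool list \<times> 's) \<Rightarrow> 's \<Rightarrow> bool word \<Rightarrow> bool word" where
  "transducer_map T q x = (THE y. \<forall>n. y \<in> cylinder (transducer_output T q (x [0 \<rightarrow> n])))"

datatype phi_state = S_L | S_R | S_A | S_B

fun T_phi :: "phi_state \<Rightarrow> bool \<Rightarrow> bool list \<times> phi_state" where
  "T_phi S_L False = ([False], S_L)"
| "T_phi S_L True  = ([True], S_R)"
| "T_phi S_R False = ([False], S_A)"
| "T_phi S_R True  = ([True], S_R)"
| "T_phi S_A False = ([False, False], S_A)"
| "T_phi S_A True  = ([], S_B)"
| "T_phi S_B False = ([False, True], S_A)"
| "T_phi S_B True  = ([True], S_R)"

definition phi :: "bool word \<Rightarrow> bool word" where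
  "phi = transducer_map T_phi S_L"

definition F_conj :: "nat \<Rightarrow> (bool word \<Rightarrow> bool word) set" where
  "F_conj i = {(phi ^^ i) \<circ> f \<circ> inv_into UNIV (phi ^^ i) | f. f \<in> carrier thompson_F}"

section \<open>The automata of the theorem\<close>

datatype a_state = q_rho | q_ell | q_r | q_c | q_a nat

definition k_index :: "nat \<Rightarrow> nat" where
  "k_index t = 2 ^ multiplicity 2 (t + 1) - 2"

fun child :: "nat \<Rightarrow> a_state \<Rightarrow> bool \<Rightarrow> a_state" where
  "child i q_rho b = (if b then q_r else q_ell)"
| "child i q_ell b = (if b then q_c else q_ell)"
| "child i q_r b = (if b then q_r else if i = 0 then q_c else q_a 0)"
| "child i q_c b = (if b then q_c else if i = 0 then q_c else q_a 0)"
| "child i (q_a t) b =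
     (if b then (if even t then q_c else q_a (k_index t)) else q_a ((t + 1) mod 2 ^ i))"

definition \<A> :: "nat \<Rightarrow> a_state automaton" where
  "\<A> i =
     (let Q = {q_rho, q_ell, q_r, q_c} \<union> (if i = 0 then {} else q_a ` {..<2 ^ i})
      in \<lparr> states = Q, root_state = q_rho, edges = {(q, b, child i q b) | q b. q \<in> Q} \<rparr>)"

end

theory Submission
  imports Defs
begin

text \<open>
  Write \<open>u ~ v\<close> if some element of \<open>H_i\<close> replaces the prefix \<open>u\<close> by \<open>v\<close>.  If a word
  leads to \<open>a_t\<close> in \<open>A_i\<close> and to state \<open>A\<close> in the transducer, then its output leads
  to \<open>a_(2t)\<close> in \<open>A_(i+1)\<close>.  Hence conjugation by \<open>phi\<close> turns maps that locally
  replace prefixes with equal states in \<open>A_i\<close> into such maps for \<open>A_(i+1)\<close>, and it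
  also carries a set of relations \<open>u ~ v\<close> that presents \<open>A_i\<close> to one that presents
  \<open>A_(i+1)\<close>.  By induction on \<open>i\<close>, starting from copies of a single generator of \<open>F\<close>,
  \<open>u ~ v\<close> holds iff \<open>u\<close> and \<open>v\<close> lead to the same state of \<open>A_i\<close>.

  The maps that locally replace prefixes with equal states in the core of \<open>S\<close> are closed under
  composition and inverses, so all of \<open>H_i\<close> has this property.  Since \<open>H_i\<close> contains
  nontrivial elements supported in arbitrarily small cylinders, every word can be read in the core,
  and by foldedness \<open>u ~ v\<close> implies that \<open>u\<close> and \<open>v\<close> lead to the same state of the
  core.  Conversely, equality of \<open>A_i\<close>-states is a relation on the tree graph that contains the
  leaf identifications and has a deterministic folded quotient, because \<open>A_i\<close> itself is folded;
  so it contains the folding relation.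
\<close>

section \<open>Finite and infinite binary words\<close>

lemma cylinder_iff: "x \<in> cylinder u \<longleftrightarrow> (\<exists>y. x = u \<frown> y)"
  by (auto simp: cylinder_def)

lemma conc_in_cylinder [simp]: "u \<frown> y \<in> cylinder u"
  by (auto simp: cylinder_def)

lemma in_cylinder_subsequence [simp]: "x \<in> cylinder (x [0 \<rightarrow> n])"
  using cylinder_iff prefix_suffix by metis

lemma in_cylinder_prefix: "x \<in> cylinder u \<Longrightarrow> Sublist.prefix w u \<Longrightarrow> x \<in> cylinder w"
  by (auto simp: cylinder_iff Sublist.prefix_def) (metis conc_conc)

lemma cylinder_comparable:
  assumes "x \<in> cylinder u" "x \<in> cylinder v"
  shows "Sublist.prefix u v \<or> Sublist.prefix v u"
proof -
  have *: "Sublist.prefix u v" if le: "length u \<le> length v" and cyl: "x \<in> cylinder u" "x \<in> cylinder v" for u v :: "bool list"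
  proof -
    obtain y z where "x = u \<frown> y" "x = v \<frown> z"
        using cyl unfolding cylinder_iff by blast
    then have "x [0 \<rightarrow> length u] = u" "x [0 \<rightarrow> length u] = take (length u) v"
      using prefix_conc_length prefix_conc_fst[OF le] by metis+
    then show ?thesis by (metis take_is_prefix)
  qed
  show ?thesis using *[of u v] *[of v u] assms by linarith
qed

lemma conc_eq_comparable:
  fixes u v :: "bool list"
  assumes "u \<frown> y = v \<frown> z"
  shows "(\<exists>t. v = u @ t) \<or> (\<exists>t. u = v @ t)"
  using cylinder_comparable[of "u \<frown> y" u v] assms conc_in_cylinder[of u y] conc_in_cylinder[of v z]
  by (auto simp: Sublist.prefix_def)

text \<open>One word extends the other by some \<open>t\<close> with \<open>y = t \<frown> y\<close>
  for all \<open>y\<close>; a nonempty \<open>t\<close> is refuted by the constant sequence of the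
  letter opposite to its first letter.\<close>

lemma conc_eq_imp_eq:
  fixes u v :: "bool list"
  assumes "\<And>y. u \<frown> y = v \<frown> y"
  shows "u = v"
proof -
  have *: "t = []" if "\<And>y. y = t \<frown> y" for t :: "bool list"
  proof (cases t)
    case (Cons a s)
    then show ?thesis using fun_cong[OF that[of "\<lambda>_. \<not> a"], of 0] by simp
  qed
  consider t where "v = u @ t" | t where "u = v @ t"
    using conc_eq_comparable[OF assms[of undefined]] by blast
  then show ?thesis
  proof cases
    case 1
    then have "y = t \<frown> y" for y using assms[of y] by (simp flip: conc_conc)
    then show ?thesis using * 1 by simp
  next
    case 2
    then have "y = t \<frown> y" for y using assms[of y] by (simp flip: conc_conc)
    then show ?thesis using * 2 by simp
  qed
qed

lemma conc_in_cylinder_append [simp]: "u \<frown> y \<in> cylinder (u @ w) \<longleftrightarrow> y \<in> cylinder w"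
  by (auto simp: cylinder_iff simp flip: conc_conc)

lemma cylinder_inject: "cylinder u = cylinder v \<Longrightarrow> u = v"
proof -
  assume *: "cylinder u = cylinder v"
  have **: "u = v" if pre: "Sublist.prefix u v" and eq: "cylinder u = cylinder v" for u v :: "bool list"
  proof -
    obtain t where t: "v = u @ t" using pre by (auto simp: Sublist.prefix_def)
    have "t = []"
    proof (cases t)
      case (Cons a s)
      have "u \<frown> (\<lambda>_. \<not> a) \<in> cylinder v" unfolding eq[symmetric] by simp
      then obtain z where "u \<frown> (\<lambda>_. \<not> a) = v \<frown> z" by (auto simp: cylinder_iff)
      then have "(\<lambda>_. \<not> a) = t \<frown> z" using t by (simp flip: conc_conc)
      from fun_cong[OF this, of 0] show ?thesis using Cons by simp
    qed
    then show ?thesis using t by simp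
  qed
  have "u \<frown> (\<lambda>_. True) \<in> cylinder v" unfolding *[symmetric] by simp
  then have "Sublist.prefix u v \<or> Sublist.prefix v u"
    using cylinder_comparable conc_in_cylinder by blast
  then show ?thesis using ** * by metis
qed

text \<open>Compactness of the Cantor space as bar induction: if \<open>P\<close> failed at the
  root, moving to a failing child forever would give a sequence that never meets
  \<open>P\<close>.\<close>

lemma bar_induct:
  fixes P :: "bool list \<Rightarrow> bool"
  assumes bar: "\<And>x. \<exists>n. P (x [0 \<rightarrow> n])"
    and step: "\<And>w. P (w @ [False]) \<Longrightarrow> P (w @ [True]) \<Longrightarrow> P w"
  shows "P []"
proof (rule ccontr)
  assume neg: "\<not> P []"
  \<comment> \<open>The next letter is 1 exactly when \<open>P\<close> holds at the 0-child; then
    \<open>step\<close> makes \<open>P\<close> fail at the 1-child.\<close>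
  define s where "s = rec_nat [] (\<lambda>_ w. w @ [P (w @ [False])])"
  have s_0: "s 0 = []" and s_Suc: "s (Suc n) = s n @ [P (s n @ [False])]" for n
    by (simp_all add: s_def)
  define x where "x n = P (s n @ [False])" for n
  have "x [0 \<rightarrow> n] = s n" for n
    by (induction n) (simp_all add: s_0 s_Suc x_def)
  moreover have "\<not> P (s n)" for n
  proof (induction n)
    case (Suc n)
    then show ?case using step[of "s n"]
      by (cases "P (s n @ [False])") (auto simp: s_Suc)
  qed (simp add: s_0 neg)
  ultimately show False using bar[of x] by simp
qed

section \<open>The lexicographic order on infinite words and monotone maps\<close>

lemma less_fun_conc [simp]: "less_fun (u \<frown> x) (u \<frown> y) \<longleftrightarrow> less_fun (x :: bool word) y"
proof
  assume "less_fun (u \<frown> x) (u \<frown> y)"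
  then obtain k where k: "(u \<frown> x) k < (u \<frown> y) k" "\<And>j. j < k \<Longrightarrow> (u \<frown> x) j = (u \<frown> y) j"
    by (auto elim: less_funE)
  then have "\<not> k < length u" by auto
  then have "x (k - length u) < y (k - length u)" using k by simp
  moreover have "x j = y j" if "j < k - length u" for j
    using k(2)[of "length u + j"] that by simp
  ultimately show "less_fun x y" by (auto simp: less_fun_def)
next
  assume "less_fun x y"
  then obtain k where k: "x k < y k" "\<And>j. j < k \<Longrightarrow> x j = y j"
    by (auto elim: less_funE)
  have "(u \<frown> x) (length u + k) < (u \<frown> y) (length u + k)" using k by simp
  moreover have "(u \<frown> x) j = (u \<frown> y) j" if "j < length u + k" for j
    using k(2)[of "j - length u"] that by (cases "j < length u") auto
  ultimately show "less_fun (u \<frown> x) (u \<frown> y)" unfolding less_fun_def by blast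
qed

lemma less_fun_build_False_True [simp]: "less_fun (False ## x) (True ## y)"
  by (auto simp: less_fun_def intro: exI[of _ 0])

lemma less_fun_build [simp]: "less_fun (b ## x) (b ## y) \<longleftrightarrow> less_fun (x :: bool word) y"
  using less_fun_conc[of "[b]" x y] by simp

lemma not_less_fun_build_True_False [simp]: "\<not> less_fun (True ## x) (False ## y)"
  using less_fun_asym less_fun_build_False_True by blast

lemma word_cases:
  obtains y where "x = False ## y" | y where "x = True ## y"
  by (metis (full_types) build_first)

lemma less_fun_cases:
  assumes "less_fun x (y :: bool word)"
  obtains p x' y' where "x = p \<frown> (False ## x')" "y = p \<frown> (True ## y')"
proof -
  obtain k where k: "x k < y k" "\<And>j. j < k \<Longrightarrow> x j = y j"
    using assms by (auto elim: less_funE)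
  have e: "x [0 \<rightarrow> k] = y [0 \<rightarrow> k]" using k by (auto simp: subsequence_def)
  have "z = z [0 \<rightarrow> k] \<frown> (z k ## Omega_Words_Fun.suffix (Suc k) z)" for z :: "bool word"
    by (metis build_first prefix_suffix suffix_nth suffix_suffix add.right_neutral add_Suc_right)
  then show thesis using that[of "x [0 \<rightarrow> k]" "Omega_Words_Fun.suffix (Suc k) x" "Omega_Words_Fun.suffix (Suc k) y"] e k
    by (metis less_bool_def)
qed

lemma less_fun_linear:
  fixes x y :: "bool word"
  shows "less_fun x y \<or> x = y \<or> less_fun y x"
proof (cases "x = y")
  case False
  define k where "k = (LEAST k. x k \<noteq> y k)"
  have "\<exists>k. x k \<noteq> y k" using False by auto
  then have "x k \<noteq> y k" unfolding k_def by (rule LeastI_ex)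
  moreover have "x j = y j" if "j < k" for j
    using not_less_Least that unfolding k_def by blast
  ultimately have "(x k < y k \<or> y k < x k) \<and> (\<forall>j<k. x j = y j)"
    by (auto simp: less_bool_def)
  then show ?thesis unfolding less_fun_def by metis
qed simp

lemma order_preserving_inject:
  assumes "order_preserving f"
  shows "inj f"
proof (rule injI)
  fix x y assume "f x = f y"
  then show "x = y" using assms less_fun_linear[of x y] less_fun_irrefl[of "f x"]
    by (auto simp: order_preserving_def) metis+
qed

lemma order_preserving_iff:
  assumes "order_preserving f"
  shows "less_fun (f x) (f y) \<longleftrightarrow> less_fun x y"
  using assms less_fun_linear[of x y] less_fun_asym less_fun_irrefl
  by (auto simp: order_preserving_def)

lemma order_preserving_comp:
  "order_preserving f \<Longrightarrow> order_preserving g \<Longrightarrow> order_preserving (f \<circ> g)"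
  by (auto simp: order_preserving_def)

lemma order_preserving_inv:
  assumes "order_preserving f" "surj f"
  shows "order_preserving (inv_into UNIV f)"
  unfolding order_preserving_def
  by (metis assms order_preserving_iff surj_f_inv_f)

text \<open>Incomparable words separate at one letter, which decides both orders. This moves the
  order of leaves to points, where monotonicity of a map applies.\<close>

lemma list_less_append: 
  fixes u v :: "bool list"
  assumes "\<not> Sublist.prefix u v" "\<not> Sublist.prefix v u"
  shows "u < v \<longleftrightarrow> less_fun (u \<frown> y) (v \<frown> z)"
proof -
  obtain p b c s t where st: "b \<noteq> c" "u = p @ b # s" "v = p @ c # t"
    using parallel_decomp[of u v] assms by blast
  have "p @ b # s < p @ c # t \<longleftrightarrow> b < c" using \<open>b \<noteq> c\<close> by (induction p) auto
  then show ?thesis using st by (cases b; cases c) (auto simp flip: conc_conc)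
qed

section \<open>Piecewise prefix replacements and Thompson's group\<close>

definition replaces :: "(bool word \<Rightarrow> bool word) \<Rightarrow> bool list \<Rightarrow> bool list \<Rightarrow> bool" where
  "replaces f u v \<longleftrightarrow> (\<forall>y. f (u \<frown> y) = v \<frown> y)"

text \<open>No finite code is mentioned: finiteness is recovered from compactness by
  \<open>bar_induct\<close>. The relation \<open>R\<close> records what is known about the chosen
  pieces.\<close>

definition piecewise ::
    "(bool list \<Rightarrow> bool list \<Rightarrow> bool) \<Rightarrow> (bool word \<Rightarrow> bool word) \<Rightarrow> bool" where
  "piecewise R f \<longleftrightarrow> (\<forall>x. \<exists>u v. x \<in> cylinder u \<and> replaces f u v \<and> R u v)"

lemma replaces_append: "replaces f u v \<Longrightarrow> replaces f (u @ t) (v @ t)"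
  by (simp add: replaces_def flip: conc_conc)

lemma replaces_unique: "replaces f u v \<Longrightarrow> replaces f u v' \<Longrightarrow> v = v'"
  by (rule conc_eq_imp_eq) (metis replaces_def)

lemma replaces_append_unique: "replaces f u v \<Longrightarrow> replaces f (u @ t) w \<Longrightarrow> w = v @ t"
  using replaces_append replaces_unique by blast

lemma replaces_comp: "replaces g u v \<Longrightarrow> replaces f v w \<Longrightarrow> replaces (f \<circ> g) u w"
  by (simp add: replaces_def)

lemma replaces_inv: "inj f \<Longrightarrow> replaces f u v \<Longrightarrow> replaces (inv_into UNIV f) v u"
proof -
  assume "inj f" "replaces f u v"
  then have "v \<frown> y = f (u \<frown> y)" for y by (simp add: replaces_def)
  then show ?thesis unfolding replaces_def by (simp only: inv_f_f[OF \<open>inj f\<close>] simp_thms)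
qed

lemma piecewise_mono: "piecewise R f \<Longrightarrow> (\<And>u v. R u v \<Longrightarrow> Q u v) \<Longrightarrow> piecewise Q f"
  unfolding piecewise_def by blast

lemma piecewise_id: "R [] [] \<Longrightarrow> piecewise R id"
  unfolding piecewise_def replaces_def cylinder_def by (intro allI exI[of _ "[]"]) auto

lemma piecewise_inv:
  assumes "bij f" "piecewise R f" "\<And>u v. R u v \<Longrightarrow> R v u"
  shows "piecewise R (inv_into UNIV f)"
  unfolding piecewise_def
proof
  fix x
  obtain u v where uv: "inv_into UNIV f x \<in> cylinder u" "replaces f u v" "R u v"
    using assms(2) by (meson piecewise_def)
  have "x = f (inv_into UNIV f x)" using assms(1) by (simp add: bij_is_surj surj_f_inv_f)
  then have "x \<in> cylinder v" using uv(1,2) by (auto simp: cylinder_iff replaces_def)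
  then show "\<exists>u v. x \<in> cylinder u \<and> replaces (inv_into UNIV f) u v \<and> R u v"
    using replaces_inv[of f u v] uv assms by (meson bij_is_inj)
qed

text \<open>At the image point, the target of a piece of \<open>f\<close> and the source of a piece
  of \<open>g\<close> are comparable, so one piece is refined; \<open>R1\<close> and
  \<open>R2\<close> are the two cases. They are phrased so as to hold for words read in a partial
  automaton too.\<close>

lemma piecewise_comp:
  assumes f: "piecewise R f" and g: "piecewise R g"
    and R1: "\<And>u v w t. R u v \<Longrightarrow> R (v @ t) w \<Longrightarrow> R (u @ t) w"
    and R2: "\<And>u v w t. R u (v @ t) \<Longrightarrow> R v w \<Longrightarrow> R u (w @ t)"
  shows "piecewise R (g \<circ> f)"
  unfolding piecewise_def
proof
  fix x
  obtain u v where uv: "x \<in> cylinder u" "replaces f u v" "R u v"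
    using f by (meson piecewise_def)
  then obtain y where y: "x = u \<frown> y" "f x = v \<frown> y" by (auto simp: cylinder_iff replaces_def)
  obtain u' v' where uv': "f x \<in> cylinder u'" "replaces g u' v'" "R u' v'"
    using g by (meson piecewise_def)
  then obtain z where z: "f x = u' \<frown> z" by (auto simp: cylinder_iff)
  consider t where "u' = v @ t" | t where "v = u' @ t"
    using conc_eq_comparable y z by metis
  then show "\<exists>u v. x \<in> cylinder u \<and> replaces (g \<circ> f) u v \<and> R u v"
  proof cases
    case 1
    then have "y = t \<frown> z" using y z by (simp flip: conc_conc)
    then have "x \<in> cylinder (u @ t)" using y by simp
    moreover have "replaces (g \<circ> f) (u @ t) v'"
      using replaces_comp replaces_append uv(2) uv'(2) 1 by blast
    ultimately show ?thesis using R1 uv(3) uv'(3) 1 by blast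
  next
    case 2
    have "replaces (g \<circ> f) u (v' @ t)"
      using replaces_comp replaces_append uv(2) uv'(2) 2 by blast
    then show ?thesis using R2 uv uv'(3) 2 by blast
  qed
qed

text \<open>Bar induction on common extensions of \<open>u\<close> and \<open>v\<close>: deep
  enough, a piece of \<open>f\<close> provides \<open>R\<close>, and \<open>fold\<close> carries it
  back up. What is known about some pieces thus holds for every replaced pair.\<close>

lemma piecewise_replaces:
  assumes f: "piecewise R f" and uv: "replaces f u v"
    and append: "\<And>u v t. R u v \<Longrightarrow> R (u @ t) (v @ t)"
    and fold: "\<And>u v. R (u @ [False]) (v @ [False]) \<Longrightarrow> R (u @ [True]) (v @ [True]) \<Longrightarrow> R u v"
  shows "R u v"
proof -
  have "R (u @ []) (v @ [])"
  proof (rule bar_induct)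
    fix x
    obtain u' v' where uv': "u \<frown> x \<in> cylinder u'" "replaces f u' v'" "R u' v'"
      using f unfolding piecewise_def by blast
    then obtain z where "u \<frown> x = u' \<frown> z" by (auto simp: cylinder_iff)
    then consider t where "u' = u @ t" | t where "u = u' @ t" using conc_eq_comparable by blast
    then show "\<exists>n. R (u @ x [0 \<rightarrow> n]) (v @ x [0 \<rightarrow> n])"
    proof cases
      case 1
      then have "x \<in> cylinder t" using uv'(1) by simp
      then have "x [0 \<rightarrow> length t] = t" by (auto simp: cylinder_iff)
      then show ?thesis using 1 uv' replaces_append_unique[OF uv] by metis
    next
      case 2
      then have "v = v' @ t" using replaces_append_unique[OF uv'(2)] uv by blast
      then have "R (u @ x [0 \<rightarrow> 0]) (v @ x [0 \<rightarrow> 0])" using 2 append uv'(3) by simp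
      then show ?thesis by blast
    qed
  qed (use fold[of "u @ _" "v @ _"] in simp)
  then show ?thesis by simp
qed

section \<open>Continuity of piecewise prefix replacements\<close>

lemma open_cylinder: "open (cylinder u)"
proof -
  have "cylinder u = (\<Inter>i<length u. (\<lambda>x. x i) -` {u ! i})"
  proof (intro equalityI subsetI)
      fix x assume "x \<in> (\<Inter>i<length u. (\<lambda>x. x i) -` {u ! i})"
      then have "x [0 \<rightarrow> length u] = u" by (auto intro: nth_equalityI)
      then show "x \<in> cylinder u" by (metis in_cylinder_subsequence)
  next
    fix x assume "x \<in> cylinder u"
    then obtain y where "x = u \<frown> y" unfolding cylinder_iff by blast
    then show "x \<in> (\<Inter>i<length u. (\<lambda>x. x i) -` {u ! i})" by simp
  qed
  moreover have "open ((\<lambda>x. x i) -` {u ! i})" for i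
    by (intro open_vimage open_discrete continuous_on_product_coordinates)
  ultimately show ?thesis by (auto intro!: open_INT)
qed

lemma piecewise_continuous:
  assumes "piecewise R f"
  shows "continuous_on UNIV f"
proof (rule continuous_on_coordinatewise_then_product)
  fix i
  show "continuous_on UNIV (\<lambda>x. f x i)"
    unfolding continuous_on_def
  proof
    fix x
    obtain u v where uv: "x \<in> cylinder u" "replaces f u v"
      using assms by (meson piecewise_def)
    then obtain y where y: "x = u \<frown> y" by (auto simp: cylinder_iff)
    \<comment> \<open>With \<open>Suc i\<close> letters after \<open>u\<close>, coordinate
      \<open>i\<close> of the image is determined even if \<open>v\<close> is empty.\<close>
    let ?w = "u @ y [0 \<rightarrow> Suc i]"
    have x: "x \<in> cylinder ?w" using y by (simp del: subseq_to_Suc)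
    have "f z i = (v @ y [0 \<rightarrow> Suc i]) ! i" if z: "z \<in> cylinder ?w" for z
    proof -
      obtain z' where "z = ?w \<frown> z'" using z unfolding cylinder_iff by blast
      then have "f z = (v @ y [0 \<rightarrow> Suc i]) \<frown> z'"
        using replaces_append[OF uv(2)] by (simp add: replaces_def del: subseq_to_Suc)
      then show ?thesis by (simp del: subseq_to_Suc)
    qed
    then have "\<forall>z\<in>cylinder ?w. f z i = f x i" using x by simp
    then have "\<forall>\<^sub>F z in at x. f z i = f x i"
      unfolding eventually_at_topological using open_cylinder x by blast
    then show "((\<lambda>x. f x i) \<longlongrightarrow> f x i) (at x)"
      by (rule tendsto_eventually)
  qed
qed

text \<open>
  The leaves of the reduced diagram are the minimal words on which \<open>f\<close> is a prefix replacement.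
\<close>

lemma reduced_tree_diagram_exists:
  assumes ord: "order_preserving f" and "surj f" and pw: "piecewise R f"
  shows "\<exists>us vs. reduced_tree_diagram f us vs"
proof -
  define U where
    "U = {u. (\<exists>v. replaces f u v) \<and> (\<forall>w. strict_prefix w u \<longrightarrow> \<not> (\<exists>v. replaces f w v))}"
  have antichain: "u = u'" if "u \<in> U" "u' \<in> U" "Sublist.prefix u u'" for u u'
    using that unfolding U_def by (auto simp: strict_prefix_def)
  have cover: "\<exists>u\<in>U. x \<in> cylinder u" for x
  proof -
    obtain u v where uv: "x \<in> cylinder u" "replaces f u v"
      using pw by (meson piecewise_def)
    define n where "n = (LEAST n. \<exists>v. replaces f (take n u) v)"
    have "\<exists>v. replaces f (take (length u) u) v" using uv by auto
    then have n: "\<exists>v. replaces f (take n u) v" "n \<le> length u"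
      unfolding n_def by (rule LeastI) (rule Least_le, use uv in auto)
    have "take n u \<in> U" unfolding U_def
    proof (intro CollectI conjI allI impI n)
      fix w assume w: "strict_prefix w (take n u)"
      then have "length w < n" using n(2) prefix_length_less by fastforce
      moreover have "w = take (length w) u"
        using w by (auto simp: strict_prefix_def Sublist.prefix_def) (metis append_eq_conv_conj append_take_drop_id append.assoc)
      ultimately show "\<not> (\<exists>v. replaces f w v)"
        using not_less_Least[of "length w"] unfolding n_def by metis
    qed
    moreover have "x \<in> cylinder (take n u)"
      using uv in_cylinder_prefix take_is_prefix by blast
    ultimately show ?thesis by blast
  qed
  \<comment> \<open>Every sequence runs through some minimal word, and by \<open>antichain\<close>
    that word is the only element of \<open>U\<close> extending it.\<close>
  have "finite {u \<in> U. Sublist.prefix [] u}"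
  proof (rule bar_induct)
    fix x
    obtain u where u: "u \<in> U" "x \<in> cylinder u" using cover by blast
    then have "x [0 \<rightarrow> length u] = u" by (auto simp: cylinder_iff)
    moreover have "{u' \<in> U. Sublist.prefix u u'} \<subseteq> {u}" using antichain u by auto
    ultimately show "\<exists>n. finite {u \<in> U. Sublist.prefix (x [0 \<rightarrow> n]) u}"
      by (metis finite.emptyI finite.insertI finite_subset)
  next
    fix w assume fin: "finite {u \<in> U. Sublist.prefix (w @ [False]) u}"
      "finite {u \<in> U. Sublist.prefix (w @ [True]) u}"
    have "{u \<in> U. Sublist.prefix w u} \<subseteq> {w} \<union> {u \<in> U. Sublist.prefix (w @ [False]) u}
            \<union> {u \<in> U. Sublist.prefix (w @ [True]) u}"
      by (auto simp: Sublist.prefix_def) (metis (full_types) append_Nil2 list.exhaust)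
    then show "finite {u \<in> U. Sublist.prefix w u}" using fin
      by (meson finite.emptyI finite.insertI finite_UnI finite_subset)
  qed
  then have fin: "finite U" by simp
  define img where "img u = (SOME v. replaces f u v)" for u
  have img: "replaces f u (img u)" if "u \<in> U" for u
    using that unfolding img_def U_def by (auto intro: someI)
  \<comment> \<open>If \<open>img u'\<close> extended \<open>img u\<close>, points of
    \<open>cylinder u\<close> and \<open>cylinder u'\<close> would have the same image and coincide
    by injectivity, making \<open>u\<close> and \<open>u'\<close> comparable.\<close>
  have incomparable: "\<not> Sublist.prefix (img u) (img u')" if "u \<in> U" "u' \<in> U" "u \<noteq> u'" for u u'
  proof
    assume "Sublist.prefix (img u) (img u')"
    then obtain t where "img u' = img u @ t" by (auto simp: Sublist.prefix_def)
    then have "f (u \<frown> t \<frown> y) = f (u' \<frown> y)" for y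
      using img that by (simp add: replaces_def flip: conc_conc)
    then have "u \<frown> t \<frown> y = u' \<frown> y" for y
      using order_preserving_inject[OF ord] by (metis injD)
    then have "Sublist.prefix u u' \<or> Sublist.prefix u' u"
      using conc_eq_comparable by (metis Sublist.prefix_def)
    then show False using antichain that by blast
  qed
  define us where "us = sorted_list_of_set U"
  have us: "set us = U" "sorted_wrt (<) us" using fin by (auto simp: us_def)
  have "sorted_wrt (\<lambda>u u'. img u < img u') us"
  proof (rule sorted_wrt_mono_rel[OF _ us(2)])
    fix u u' assume u: "u \<in> set us" "u' \<in> set us" "u < u'"
    then have "u \<in> U" "u' \<in> U" "u \<noteq> u'" using us by auto
    have "less_fun (u \<frown> (\<lambda>_. True)) (u' \<frown> (\<lambda>_. True))"
      using list_less_append[of u u'] u antichain us \<open>u \<noteq> u'\<close> by metis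
    then have "less_fun (img u \<frown> (\<lambda>_. True)) (img u' \<frown> (\<lambda>_. True))"
      using ord img \<open>u \<in> U\<close> \<open>u' \<in> U\<close> unfolding order_preserving_def replaces_def by metis
    then show "img u < img u'"
      using list_less_append incomparable \<open>u \<in> U\<close> \<open>u' \<in> U\<close> \<open>u \<noteq> u'\<close> by metis
  qed
  then have "sorted_wrt (<) (map img us)" by (simp add: sorted_wrt_map)
  moreover have "complete_prefix_code U"
    unfolding complete_prefix_code_def using fin antichain cover by blast
  moreover have "(\<Union>u\<in>U. cylinder (img u)) = UNIV"
  proof -
    have "x \<in> (\<Union>u\<in>U. cylinder (img u))" for x
    proof -
      obtain y where y: "x = f y" using \<open>surj f\<close> by blast
      obtain u where "u \<in> U" "y \<in> cylinder u" using cover by blast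
      then show ?thesis using img y by (auto simp: cylinder_iff replaces_def)
    qed
    then show ?thesis by blast
  qed
  then have "complete_prefix_code (set (map img us))"
    unfolding complete_prefix_code_def using incomparable us(1) fin by auto
  ultimately have "tree_diagram us (map img us)" using us by (simp add: tree_diagram_def)
  moreover have "represents us (map img us) f"
    using img us(1) by (auto simp: represents_def replaces_def)
  \<comment> \<open>A reducible pair of leaves would make \<open>f\<close> replace \<open>u\<close>
    by \<open>v\<close>, against the minimality of \<open>u @ [False]\<close>.\<close>
  moreover have "reduced us (map img us)"
    unfolding reduced_def
  proof clarify
    fix j u v assume j: "Suc j < length us" "us ! j = u @ [False]" "us ! Suc j = u @ [True]"
      "map img us ! j = v @ [False]" "map img us ! Suc j = v @ [True]"
    then have U: "u @ [False] \<in> U" "u @ [True] \<in> U"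
      using us(1) by (metis Suc_lessD nth_mem)+
    then have "replaces f (u @ [False]) (v @ [False])" "replaces f (u @ [True]) (v @ [True])"
      using img[OF U(1)] img[OF U(2)] j by auto
    then have "f (u \<frown> (b ## y)) = v \<frown> (b ## y)" for b y
      by (cases b) (auto simp: replaces_def simp flip: conc_conc)
    then have "replaces f u v" unfolding replaces_def by (metis build_first)
    then show False using U(1) by (auto simp: U_def strict_prefix_def)
  qed
  ultimately show ?thesis unfolding reduced_tree_diagram_def by blast
qed

section \<open>Local description of F and its group operations\<close>

lemma complete_prefix_code_cover: "complete_prefix_code U \<Longrightarrow> \<exists>u\<in>U. x \<in> cylinder u"
  unfolding complete_prefix_code_def by blast

text \<open>Monotonicity gives injectivity, the pieces give continuity in both directions, and
  compactness gives the finite diagram.\<close>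

lemma thompson_F_iff:
  "f \<in> carrier thompson_F \<longleftrightarrow> order_preserving f \<and> surj f \<and> piecewise (\<lambda>_ _. True) f"
proof
  assume "f \<in> carrier thompson_F"
  then obtain g us vs where f: "homeomorphism UNIV UNIV f g" "order_preserving f"
    "tree_diagram us vs" "represents us vs f"
    by (auto simp: thompson_F_def)
  have "\<exists>u v. x \<in> cylinder u \<and> replaces f u v" for x
  proof -
    obtain u where u: "u \<in> set us" "x \<in> cylinder u"
      using f(3) complete_prefix_code_cover by (metis tree_diagram_def)
    then obtain i where "i < length us" "us ! i = u" by (metis in_set_conv_nth)
    then show ?thesis using f(4) u by (auto simp: represents_def replaces_def)
  qed
  then show "order_preserving f \<and> surj f \<and> piecewise (\<lambda>_ _. True) f"
    using f by (auto simp: homeomorphism_def piecewise_def)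
next
  assume f: "order_preserving f \<and> surj f \<and> piecewise (\<lambda>_ _. True) f"
  then have "bij f" using order_preserving_inject by (simp add: bij_def)
  have "homeomorphism UNIV UNIV f (inv_into UNIV f)"
    unfolding homeomorphism_def
  proof (intro conjI ballI)
    show "continuous_on UNIV f" "continuous_on UNIV (inv_into UNIV f)"
      using f piecewise_inv[OF \<open>bij f\<close>] piecewise_continuous by blast+
  qed (use f \<open>bij f\<close> bij_imp_bij_inv[OF \<open>bij f\<close>] in
       \<open>simp_all add: surj_f_inv_f bij_is_inj bij_is_surj\<close>)
  then show "f \<in> carrier thompson_F"
    using f reduced_tree_diagram_exists[of f "\<lambda>_ _. True"]
    by (auto simp: thompson_F_def reduced_tree_diagram_def)
qed

lemma thompson_F_bij: "f \<in> carrier thompson_F \<Longrightarrow> bij f"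
  using thompson_F_iff order_preserving_inject by (simp add: bij_def)

lemma thompson_F_reduced_tree_diagram:
  "f \<in> carrier thompson_F \<Longrightarrow> \<exists>us vs. reduced_tree_diagram f us vs"
  using reduced_tree_diagram_exists[of f "\<lambda>_ _. True"] by (simp add: thompson_F_iff)

lemma thompson_F_id: "id \<in> carrier thompson_F"
  unfolding thompson_F_iff by (simp add: order_preserving_def piecewise_id)

lemma thompson_F_comp:
  "f \<in> carrier thompson_F \<Longrightarrow> g \<in> carrier thompson_F \<Longrightarrow> g \<circ> f \<in> carrier thompson_F"
  unfolding thompson_F_iff
  using order_preserving_comp[of g f] comp_surj[of f g] piecewise_comp[of "\<lambda>_ _. True" f g] by blast

lemma thompson_F_inv: "f \<in> carrier thompson_F \<Longrightarrow> inv_into UNIV f \<in> carrier thompson_F"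
  using thompson_F_bij[of f] bij_imp_bij_inv[of f] unfolding thompson_F_iff
  by (simp add: order_preserving_inv piecewise_inv bij_is_surj)

lemma thompson_F_mult [simp]: "f \<otimes>\<^bsub>thompson_F\<^esub> g = f \<circ> g"
  and thompson_F_one [simp]: "\<one>\<^bsub>thompson_F\<^esub> = id"
  by (simp_all add: thompson_F_def)

lemma thompson_F_m_inv:
  assumes "f \<in> carrier thompson_F"
  shows "inv\<^bsub>thompson_F\<^esub> f = inv_into UNIV f"
  unfolding m_inv_def
proof (rule the_equality)
  have "bij f" using thompson_F_bij assms .
  then show "inv_into UNIV f \<in> carrier thompson_F \<and>
      f \<otimes>\<^bsub>thompson_F\<^esub> inv_into UNIV f = \<one>\<^bsub>thompson_F\<^esub> \<and>
      inv_into UNIV f \<otimes>\<^bsub>thompson_F\<^esub> f = \<one>\<^bsub>thompson_F\<^esub>"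
    using thompson_F_inv assms by (auto simp: fun_eq_iff bij_is_surj surj_f_inv_f bij_is_inj)
  fix g assume "g \<in> carrier thompson_F \<and> f \<otimes>\<^bsub>thompson_F\<^esub> g = \<one>\<^bsub>thompson_F\<^esub> \<and>
      g \<otimes>\<^bsub>thompson_F\<^esub> f = \<one>\<^bsub>thompson_F\<^esub>"
  then show "g = inv_into UNIV f"
    by (metis inv_unique_comp thompson_F_mult thompson_F_one)
qed

section \<open>Copies of elements inside a cylinder, and one generator\<close>

definition plant :: "bool \<Rightarrow> (bool word \<Rightarrow> bool word) \<Rightarrow> bool word \<Rightarrow> bool word" where
  "plant b f x = (if x 0 = b then b ## f (Omega_Words_Fun.suffix 1 x) else x)"

lemma suffix_build [simp]: "Omega_Words_Fun.suffix (Suc n) (b ## y) = Omega_Words_Fun.suffix n y"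
  by (simp add: fun_eq_iff)

lemma plant_build [simp]: "plant b f (c ## y) = c ## (if c = b then f y else y)"
  by (simp add: plant_def)

lemma build_cases: obtains b y where "x = b ## y"
  by (metis build_first)

lemma thompson_F_plant:
  assumes "f \<in> carrier thompson_F"
  shows "plant b f \<in> carrier thompson_F"
proof -
  have f: "order_preserving f" "surj f" "piecewise (\<lambda>_ _. True) f"
    using assms by (auto simp: thompson_F_iff)
  have "order_preserving (plant b f)"
    unfolding order_preserving_def
  proof (intro allI impI)
    fix x y :: "bool word"
    assume less: "less_fun x y"
    obtain c x' where x: "x = c ## x'" by (rule build_cases)
    obtain d y' where y: "y = d ## y'" by (rule build_cases)
    show "less_fun (plant b f x) (plant b f y)"
      using less f(1) unfolding x y order_preserving_def by (cases c; cases d) auto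
  qed
  moreover have "x \<in> range (plant b f)" for x
  proof -
    obtain c y where x: "x = c ## y" by (rule build_cases)
    show ?thesis
    proof (cases "c = b")
      case True
      obtain z where "y = f z" using f(2) by blast
      then have "plant b f (b ## z) = x" using x True by simp
      then show ?thesis by blast
    next
      case False
      then have "plant b f x = x" using x by simp
      then show ?thesis by (metis rangeI)
    qed
  qed
  moreover have "\<exists>u v. x \<in> cylinder u \<and> replaces (plant b f) u v" for x
  proof -
    obtain c y where x: "x = c ## y" by (rule build_cases)
    show ?thesis
    proof (cases "c = b")
      case True
      obtain u v where uv: "y \<in> cylinder u" "replaces f u v"
        using f(3) by (meson piecewise_def)
      then have "x \<in> cylinder (b # u)" "replaces (plant b f) (b # u) (b # v)"
        using True x by (auto simp: cylinder_iff replaces_def)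
      then show ?thesis by blast
    next
      case False
      then have "x \<in> cylinder [c]" "replaces (plant b f) [c] [c]"
        using x by (auto simp: cylinder_iff replaces_def)
      then show ?thesis by blast
    qed
  qed
  ultimately show ?thesis unfolding thompson_F_iff piecewise_def by blast
qed

text \<open>The copy of \<open>f\<close> supported in \<open>cylinder u\<close>; the first letter of
  \<open>u\<close> is the outermost \<open>plant\<close>. Such copies supply the relations of the
  base case and elements of small support.\<close>

definition plant_at :: "bool list \<Rightarrow> (bool word \<Rightarrow> bool word) \<Rightarrow> bool word \<Rightarrow> bool word" where
  "plant_at u f = foldr plant u f"

lemma thompson_F_plant_at: "f \<in> carrier thompson_F \<Longrightarrow> plant_at u f \<in> carrier thompson_F"
  unfolding plant_at_def by (induction u) (simp_all add: thompson_F_plant)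

lemma plant_at_conc: "plant_at u f (u \<frown> y) = u \<frown> f y"
  unfolding plant_at_def by (induction u) simp_all

lemma plant_at_outside: "x \<notin> cylinder u \<Longrightarrow> plant_at u f x = x"
proof (induction u arbitrary: x)
  case (Cons b u)
  obtain c y where x: "x = c ## y" by (rule build_cases)
  have "y \<notin> cylinder u" if "c = b" using Cons.prems that x by (auto simp: cylinder_iff)
  then show ?case using Cons.IH[of y] x by (simp add: plant_at_def)
qed (simp add: cylinder_iff)

lemma replaces_plant_at: "replaces f v w \<Longrightarrow> replaces (plant_at u f) (u @ v) (u @ w)"
  by (simp add: replaces_def plant_at_conc flip: conc_conc)

text \<open>The standard first generator of F or, depending on the convention, its inverse.\<close>

definition x_zero :: "bool word \<Rightarrow> bool word" where
  "x_zero x = (if x 0 then if x 1 then Omega_Words_Fun.suffix 1 x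
     else False ## True ## Omega_Words_Fun.suffix 2 x else False ## x)"

lemma x_zero_simps [simp]:
  "x_zero (False ## y) = False ## False ## y"
  "x_zero (True ## False ## y) = False ## True ## y"
  "x_zero (True ## True ## y) = True ## y"
  by (simp_all add: x_zero_def numeral_2_eq_2)

lemma replaces_x_zero:
  "replaces x_zero [False] [False, False]"
  "replaces x_zero [True, False] [False, True]"
  "replaces x_zero [True, True] [True]"
  by (simp_all add: replaces_def)

lemma build2_cases:
  obtains y where "x = False ## y" | y where "x = True ## False ## y" | y where "x = True ## True ## y"
  by (metis (full_types) build_first)

lemma thompson_F_x_zero: "x_zero \<in> carrier thompson_F"
proof -
  have "order_preserving x_zero"
    unfolding order_preserving_def
  proof (intro allI impI)
    fix x y :: "bool word"
    assume "less_fun x y"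
    then show "less_fun (x_zero x) (x_zero y)"
      by (cases x rule: build2_cases; cases y rule: build2_cases) auto
  qed
  moreover have "x \<in> range x_zero" for x
  proof -
    \<comment> \<open>Candidate preimages for sequences beginning with 00, 01 and 1,
      respectively.\<close>
    have "x \<in> {x_zero (False ## Omega_Words_Fun.suffix 2 x), 
       x_zero (True ## False ## Omega_Words_Fun.suffix 2 x), x_zero (True ## x)}"
    proof (cases x rule: word_cases)
      case (1 y)
      then show ?thesis by (cases y rule: word_cases) (auto simp: numeral_2_eq_2)
    qed simp
    then show ?thesis by blast
  qed
  moreover have "\<exists>u v. x \<in> cylinder u \<and> replaces x_zero u v" for x
  proof -
    have "x \<in> cylinder [False] \<or> x \<in> cylinder [True, False] \<or> x \<in> cylinder [True, True]"
      by (cases x rule: build2_cases) (auto simp: cylinder_iff)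
    then show ?thesis using replaces_x_zero by blast
  qed
  ultimately show ?thesis unfolding thompson_F_iff piecewise_def by blast
qed

section \<open>The transducer and conjugation by it\<close>

definition transducer_state :: "('s \<Rightarrow> bool \<Rightarrow> bool list \<times> 's) \<Rightarrow> 's \<Rightarrow> bool list \<Rightarrow> 's" where
  "transducer_state T = foldl (\<lambda>q b. snd (T q b))"

lemma transducer_state_simps [simp]:
  "transducer_state T q [] = q"
  "transducer_state T q (b # w) = transducer_state T (snd (T q b)) w"
  "transducer_state T q (u @ w) = transducer_state T (transducer_state T q u) w"
  by (simp_all add: transducer_state_def)

lemma transducer_output_append [simp]:
  "transducer_output T q (u @ w) =
     transducer_output T q u @ transducer_output T (transducer_state T q u) w"
  by (induction u arbitrary: q) simp_all

text \<open>Single silent transitions are allowed, since \<open>T_phi\<close> and its inverse each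
  have one; two consecutive letters must produce output, so outputs grow without bound.\<close>

locale productive_transducer =
  fixes T :: "'s \<Rightarrow> bool \<Rightarrow> bool list \<times> 's"
  assumes two_letters: "transducer_output T q [b, c] \<noteq> []"
begin

lemma output_unbounded: "\<exists>m. n < length (transducer_output T q (x [0 \<rightarrow> m]))"
proof (induction n arbitrary: q x)
  case 0
  have "x [0 \<rightarrow> 2] = [x 0, x 1]" by (simp add: numeral_2_eq_2)
  then show ?case using two_letters by (metis length_greater_0_conv)
next
  case (Suc n)
  let ?q = "transducer_state T q [x 0, x 1]"
  obtain m where m: "n < length (transducer_output T ?q (Omega_Words_Fun.suffix 2 x [0 \<rightarrow> m]))"
    using Suc by blast
  have "x [0 \<rightarrow> 2] = [x 0, x 1]" by (simp add: numeral_2_eq_2)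
  then have x: "[x 0, x 1] \<frown> Omega_Words_Fun.suffix 2 x = x" using prefix_suffix[of x 2] by simp
  have "([x 0, x 1] \<frown> Omega_Words_Fun.suffix 2 x) [0 \<rightarrow> 2 + m] =
      [x 0, x 1] @ Omega_Words_Fun.suffix 2 x [0 \<rightarrow> m]"
    by (subst prefix_conc_snd) simp_all
  then have "x [0 \<rightarrow> 2 + m] = [x 0, x 1] @ Omega_Words_Fun.suffix 2 x [0 \<rightarrow> m]"
    unfolding x .
  then have "transducer_output T q (x [0 \<rightarrow> 2 + m]) =
      transducer_output T q [x 0, x 1] @
      transducer_output T ?q (Omega_Words_Fun.suffix 2 x [0 \<rightarrow> m])"
    by (simp only: transducer_output_append)
  moreover have "0 < length (transducer_output T q [x 0, x 1])"
    using two_letters by blast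
  ultimately have "Suc n < length (transducer_output T q (x [0 \<rightarrow> 2 + m]))"
    using m by (simp only: length_append)
  then show ?case by blast
qed

lemma output_mono:
  "m \<le> n \<Longrightarrow> Sublist.prefix (transducer_output T q (x [0 \<rightarrow> m])) (transducer_output T q (x [0 \<rightarrow> n]))"
  using subsequence_append[of x m "n - m"] by simp

text \<open>The outputs on prefixes of \<open>x\<close> form a chain of unbounded length, so each
  coordinate of the limit is fixed by any long enough output. This justifies the definite
  description in \<open>transducer_map\<close>.\<close>

lemma ex1_limit: "\<exists>!y. \<forall>n. y \<in> cylinder (transducer_output T q (x [0 \<rightarrow> n]))"
proof (rule ex_ex1I)
  define w where "w n = transducer_output T q (x [0 \<rightarrow> n])" for n
  define y where "y k = w (SOME m. k < length (w m)) ! k" for k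
  have "y k = w n ! k" if "k < length (w n)" for k n
  proof -
    let ?m = "SOME m. k < length (w m)"
    have "k < length (w ?m)" by (rule someI_ex) (use that in blast)
    moreover have "Sublist.prefix (w ?m) (w n) \<or> Sublist.prefix (w n) (w ?m)"
      using output_mono unfolding w_def by (meson linear)
    ultimately show ?thesis using that unfolding y_def
      by (auto simp: Sublist.prefix_def nth_append)
  qed
  then have "y [0 \<rightarrow> length (w n)] = w n" for n
    by (auto intro: nth_equalityI)
  then have "y \<in> cylinder (w n)" for n
    by (metis in_cylinder_subsequence)
  then show "\<exists>y. \<forall>n. y \<in> cylinder (transducer_output T q (x [0 \<rightarrow> n]))"
    unfolding w_def by blast
next
  fix y z
  assume *: "\<forall>n. y \<in> cylinder (transducer_output T q (x [0 \<rightarrow> n]))"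
    "\<forall>n. z \<in> cylinder (transducer_output T q (x [0 \<rightarrow> n]))"
  show "y = z"
  proof
    fix k
    obtain m where m: "k < length (transducer_output T q (x [0 \<rightarrow> m]))" 
      using output_unbounded by blast
    have "v k = transducer_output T q (x [0 \<rightarrow> m]) ! k"
      if "v \<in> cylinder (transducer_output T q (x [0 \<rightarrow> m]))" for v
      using that m by (auto simp: cylinder_iff)
    then show "y k = z k" using * by metis
  qed
qed

lemma transducer_map_cylinder:
  "transducer_map T q x \<in> cylinder (transducer_output T q (x [0 \<rightarrow> n]))"
  using theI'[OF ex1_limit, of q x] unfolding transducer_map_def by blast

lemma transducer_map_build:
  "transducer_map T q (b ## x) = fst (T q b) \<frown> transducer_map T (snd (T q b)) x"
proof -
  have "fst (T q b) \<frown> transducer_map T (snd (T q b)) x \<in>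
      cylinder (transducer_output T q ((b ## x) [0 \<rightarrow> n]))" for n
  proof (cases n)
    case 0
    then show ?thesis by (simp add: cylinder_iff)
  next
    case (Suc m)
    have "(b ## x) [0 \<rightarrow> Suc m] = b # x [0 \<rightarrow> m]"
      using prefix_conc_snd[of "[b]" "Suc m" x] by simp
    then show ?thesis using Suc transducer_map_cylinder by simp
  qed
  then show ?thesis
    using ex1_limit[of q "b ## x"] transducer_map_cylinder[of q "b ## x"] by blast
qed

lemma transducer_map_conc:
  "transducer_map T q (u \<frown> x) = transducer_output T q u \<frown> transducer_map T (transducer_state T q u) x"
  by (induction u arbitrary: q) (simp_all add: transducer_map_build)

end

interpretation T_phi: productive_transducer T_phi
proof
  fix q b c show "transducer_output T_phi q [b, c] \<noteq> []"
    by (cases q; cases b; cases c) simp_all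
qed

text \<open>
  The inverse transducer; \<open>I_A0\<close> is \<open>I_A\<close> with one letter 0 buffered.
\<close>

datatype psi_state = I_L | I_R | I_A | I_A0

fun T_psi :: "psi_state \<Rightarrow> bool \<Rightarrow> bool list \<times> psi_state" where
  "T_psi I_L False = ([False], I_L)"
| "T_psi I_L True  = ([True], I_R)"
| "T_psi I_R False = ([False], I_A)"
| "T_psi I_R True  = ([True], I_R)"
| "T_psi I_A False = ([], I_A0)"
| "T_psi I_A True  = ([True, True], I_R)"
| "T_psi I_A0 False = ([False], I_A)"
| "T_psi I_A0 True  = ([True, False], I_A)"

interpretation T_psi: productive_transducer T_psi
proof
  fix q b c show "transducer_output T_psi q [b, c] \<noteq> []"
    by (cases q; cases b; cases c) simp_all
qed

text \<open>Strong induction on the coordinate, with the three states together because they call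
  each other. From \<open>S_A\<close> the composite consumes two letters of \<open>z\<close> if the
  first is 0 and one otherwise, hence both kinds of recursive use.\<close>

lemma T_phi_T_psi_nth:
  "transducer_map T_phi S_L (transducer_map T_psi I_L z) k = z k \<and>
   transducer_map T_phi S_R (transducer_map T_psi I_R z) k = z k \<and>
   transducer_map T_phi S_A (transducer_map T_psi I_A z) k = z k"
proof (induction k arbitrary: z rule: less_induct)
  case (less k)
  note [simp] = T_phi.transducer_map_build T_psi.transducer_map_build
  obtain b y where z: "z = b ## y" by (rule build_cases)
  obtain c x where y: "y = c ## x" by (rule build_cases)
  have "transducer_map T_phi S_L (transducer_map T_psi I_L z) k = z k"
    "transducer_map T_phi S_R (transducer_map T_psi I_R z) k = z k"
    using less[of "k - 1" y] unfolding z by (cases b; cases k; simp)+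
  moreover have "transducer_map T_phi S_A (transducer_map T_psi I_A z) k = z k"
  proof (cases k)
    case 0
    then show ?thesis unfolding z y by (cases b; cases c; simp)
  next
    case (Suc j)
    then show ?thesis
      using less[of j y] less[of "j - 1" x] unfolding z y by (cases b; cases c; cases j; simp)
  qed
  ultimately show ?case by blast
qed

lemma T_phi_T_psi:
  "transducer_map T_phi S_L (transducer_map T_psi I_L z) = z"
  "transducer_map T_phi S_R (transducer_map T_psi I_R z) = z"
  "transducer_map T_phi S_A (transducer_map T_psi I_A z) = z"
  by (rule ext, simp add: T_phi_T_psi_nth)+

text \<open>From \<open>S_B\<close> every output begins with 01 or 1, so its map misses
  \<open>cylinder [False, False]\<close>. This is the source of the condition
  \<open>q \<noteq> S_B\<close> below.\<close>

lemma surj_T_phi: "q \<noteq> S_B \<Longrightarrow> surj (transducer_map T_phi q)"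
  by (cases q) (metis T_phi_T_psi surjI)+

lemma surj_phi: "surj phi"
  unfolding phi_def by (simp add: surj_T_phi)

lemma order_preserving_T_phi: "order_preserving (transducer_map T_phi q)"
  unfolding order_preserving_def
proof (intro allI impI)
  fix x y :: "bool word"
  assume "less_fun x y"
  then obtain p x' y' where xy: "x = p \<frown> (False ## x')" "y = p \<frown> (True ## y')"
    by (rule less_fun_cases)
  \<comment> \<open>The delicate state is \<open>S_A\<close>, silent on 1: the next letter then
    yields 01 or 1, still above the 00 produced by 0.\<close>
  have "less_fun (transducer_map T_phi q (False ## x')) (transducer_map T_phi q (True ## y'))" for q
    by (cases q; cases y' rule: word_cases) (auto simp: T_phi.transducer_map_build)
  then show "less_fun (transducer_map T_phi q x) (transducer_map T_phi q y)"
    unfolding xy T_phi.transducer_map_conc by simp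
qed

lemma order_preserving_phi: "order_preserving phi"
  unfolding phi_def by (rule order_preserving_T_phi)

lemma bij_phi: "bij phi"
  using surj_phi order_preserving_phi order_preserving_inject by (simp add: bij_def)

section \<open>Conjugation by \<open>phi\<close> and the recursion for the groups H_i\<close>

abbreviation phi_output :: "bool list \<Rightarrow> bool list" where
  "phi_output \<equiv> transducer_output T_phi S_L"

abbreviation phi_state_at :: "bool list \<Rightarrow> phi_state" where
  "phi_state_at \<equiv> transducer_state T_phi S_L"

lemma phi_conc:
  "phi (u \<frown> x) = phi_output u \<frown> transducer_map T_phi (phi_state_at u) x"
  unfolding phi_def by (rule T_phi.transducer_map_conc)

definition conj_phi :: "(bool word \<Rightarrow> bool word) \<Rightarrow> bool word \<Rightarrow> bool word" where
  "conj_phi f = phi \<circ> f \<circ> inv_into UNIV phi"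

lemma conj_phi_phi [simp]: "conj_phi f (phi x) = phi (f x)"
  using bij_phi by (simp add: conj_phi_def bij_is_inj)

lemma F_conj_0: "F_conj 0 = carrier thompson_F"
  by (auto simp: F_conj_def)

lemma F_conj_Suc: "F_conj (Suc i) = conj_phi ` F_conj i"
proof -
  have "bij (phi ^^ i)" using bij_phi by (rule bij_fn)
  then have "inv_into UNIV (phi ^^ Suc i) = inv_into UNIV (phi ^^ i) \<circ> inv_into UNIV phi"
    using bij_phi by (simp add: o_inv_distrib)
  then have "(phi ^^ Suc i) \<circ> f \<circ> inv_into UNIV (phi ^^ Suc i) =
      conj_phi ((phi ^^ i) \<circ> f \<circ> inv_into UNIV (phi ^^ i))" for f
    by (simp add: conj_phi_def comp_assoc)
  then show ?thesis unfolding F_conj_def by auto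
qed

text \<open>
  This is why conjugation by \<open>phi\<close> preserves piecewise prefix replacements: after a
  replacement of \<open>u\<close> by \<open>v\<close>, the runs on \<open>u \<frown> y\<close> and \<open>v \<frown> y\<close> merge
  within three letters of \<open>y\<close>.
\<close>

lemma T_phi_sync:
  assumes "q = S_L \<longleftrightarrow> q' = S_L"
  obtains n where "transducer_state T_phi q (y [0 \<rightarrow> n]) = transducer_state T_phi q' (y [0 \<rightarrow> n])"
    and "transducer_state T_phi q (y [0 \<rightarrow> n]) \<noteq> S_B"
proof -
  have *: "\<exists>t\<in>{[], [a], [a, b], [a, b, c]}. transducer_state T_phi q t = transducer_state T_phi q' t \<and>
      transducer_state T_phi q t \<noteq> S_B" for a b c
    using assms by (cases q; cases q'; cases a; cases b; cases c) simp_all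
  have e: "y [0 \<rightarrow> 0] = []" "y [0 \<rightarrow> 1] = [y 0]" "y [0 \<rightarrow> 2] = [y 0, y 1]" "y [0 \<rightarrow> 3] = [y 0, y 1, y 2]"
    by (simp_all add: eval_nat_numeral)
  obtain t where t: "t \<in> {[], [y 0], [y 0, y 1], [y 0, y 1, y 2]}"
    "transducer_state T_phi q t = transducer_state T_phi q' t" "transducer_state T_phi q t \<noteq> S_B"
    using * by blast
  have "t = y [0 \<rightarrow> 0] \<or> t = y [0 \<rightarrow> 1] \<or> t = y [0 \<rightarrow> 2] \<or> t = y [0 \<rightarrow> 3]"
    using t(1) unfolding e by simp
  then obtain n where "t = y [0 \<rightarrow> n]" by blast
  then show thesis using that t by blast
qed

section \<open>Runs in A_i and the effect of the transducer on states\<close>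

abbreviation run_A :: "nat \<Rightarrow> bool list \<Rightarrow> a_state" where
  "run_A i \<equiv> foldl (child i) q_rho"

lemma two_power_multiplicity_le: "2 ^ multiplicity 2 (t + 1) \<le> t + (1 :: nat)"
  by (rule dvd_imp_le) (simp_all add: multiplicity_dvd)

text \<open>Since \<open>k_index t + 2\<close> is a power of 2 dividing \<open>t + 1\<close>, one
  further step from \<open>k_index t\<close> does not wrap around. The doubling rule is what relates
  the 1-edges of A_i and A_(i+1).\<close>

lemma k_index_odd:
  assumes "odd t"
  shows "even (k_index t)" "t < 2 ^ i \<Longrightarrow> Suc (k_index t) < 2 ^ i"
    "k_index (Suc (2 * t)) = 2 * k_index t + 2"
proof -
  have pos: "multiplicity 2 (t + 1) > 0"
    using assms by (simp add: multiplicity_gt_zero_iff)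
  then have ge: "(2 :: nat) ^ multiplicity 2 (t + 1) \<ge> 2" by (metis One_nat_def Suc_leI power_increasing power_one_right one_le_numeral)
  show "even (k_index t)" using pos ge by (simp add: k_index_def)
  show "Suc (k_index t) < 2 ^ i" if "t < 2 ^ i"
    using two_power_multiplicity_le[of t] that ge unfolding k_index_def by linarith
  have "multiplicity 2 (Suc (2 * t) + 1) = Suc (multiplicity 2 (t + 1))"
    using multiplicity_times_same[of "t + 1" "2 :: nat"] by simp
  then show "k_index (Suc (2 * t)) = 2 * k_index t + 2"
    using ge unfolding k_index_def by simp
qed

lemma k_index_Suc_double_even: "even t \<Longrightarrow> k_index (Suc (2 * t)) = 0"
proof -
  assume "even t"
  then have "multiplicity 2 (t + 1) = 0" by (simp add: not_dvd_imp_multiplicity_0)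
  then have "multiplicity 2 (Suc (2 * t) + 1) = 1"
    using multiplicity_times_same[of "t + 1" "2 :: nat"] by simp
  then show ?thesis by (simp add: k_index_def)
qed

definition A_states :: "nat \<Rightarrow> a_state set" where
  "A_states i = {q_rho, q_ell, q_r, q_c} \<union> (if i = 0 then {} else q_a ` {..<2 ^ i})"

lemma A_automaton: "\<A> i = \<lparr>states = A_states i, root_state = q_rho,
    edges = {(q, b, child i q b) | q b. q \<in> A_states i}\<rparr>"
  by (simp add: \<A>_def A_states_def Let_def)

lemma child_in_A_states: "q \<in> A_states i \<Longrightarrow> child i q b \<in> A_states i"
  using k_index_odd(2)[of _ i] by (cases q) (auto simp: A_states_def Suc_lessD split: if_splits)

lemma run_A_in_A_states: "run_A i w \<in> A_states i"
  by (induction w rule: rev_induct) (simp_all add: child_in_A_states, simp add: A_states_def)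

text \<open>This is the foldedness of A_i. Among the cyclic states the 0-child determines the index;
  the last one shares its 0-child with \<open>q_r\<close> and \<open>q_c\<close>, but its index is
  odd, so its 1-child differs from theirs.\<close>

lemma child_inject:
  assumes "p \<in> A_states i" "q \<in> A_states i" "\<And>b. child i p b = child i q b"
  shows "p = q"
proof -
  have mod: "t = t'" if "Suc t mod 2 ^ i = Suc t' mod 2 ^ i" "t < 2 ^ i" "t' < 2 ^ i" for t t' :: nat
    using that by (metis Suc_lessI mod_less mod_self nat.distinct(1) nat.inject)
  have last: "odd t" if "2 ^ i dvd Suc t" "i > 0" for t
    using that by (metis dvd_power dvd_trans even_Suc)
  show ?thesis
    using assms(1,2) assms(3)[of False] assms(3)[of True]
    by (cases p; cases q) (auto simp: A_states_def split: if_splits dest: mod last)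
qed

text \<open>
  The \<open>A_i\<close>-state \<open>s\<close> of a word, the transducer state \<open>q\<close> after it and the
  \<open>A_(i+1)\<close>-state \<open>s'\<close> of its output.  In state \<open>S_B\<close> the last letter has
  produced no output yet, so \<open>s\<close> is one step ahead of \<open>s'\<close>.
\<close>

definition phi_related :: "nat \<Rightarrow> phi_state \<Rightarrow> a_state \<Rightarrow> a_state \<Rightarrow> bool" where
  "phi_related i q s s' \<longleftrightarrow> (case q of
      S_L \<Rightarrow> s = s' \<and> s \<in> {q_rho, q_ell}
    | S_R \<Rightarrow> s = s' \<and> s \<in> {q_r, q_c}
    | S_A \<Rightarrow> \<exists>t<2 ^ i. s = (if i = 0 then q_c else q_a t) \<and> s' = q_a (2 * t)
    | S_B \<Rightarrow> \<exists>t<2 ^ i. s = child i (if i = 0 then q_c else q_a t) True \<and> s' = q_a (2 * t))"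

lemma phi_related_A: "phi_related i S_A (if i = 0 then q_c else q_a 0) (q_a 0)"
  unfolding phi_related_def by (auto intro!: exI[of _ 0])

text \<open>The decisive case is \<open>S_B\<close> reading 0: the output 01 leads from
  \<open>q_a (2 * t)\<close> to index \<open>k_index (2 * t + 1)\<close>, which is 0 for even
  \<open>t\<close> and \<open>2 * (k_index t + 1)\<close> for odd \<open>t\<close>, twice the index
  reached in A_i.\<close>

lemma phi_related_step:
  assumes "phi_related i q s s'"
  shows "phi_related i (snd (T_phi q b)) (child i s b) (foldl (child (Suc i)) s' (fst (T_phi q b)))"
proof (cases q)
  case S_L
  then show ?thesis using assms by (cases b) (auto simp: phi_related_def)
next
  case S_R
  then have s: "s' = s" "s = q_r \<or> s = q_c" using assms by (auto simp: phi_related_def)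
  show ?thesis
  proof (cases b)
    case True
    then show ?thesis using s S_R by (auto simp: phi_related_def)
  next
    case False
    then have "child i s b = (if i = 0 then q_c else q_a 0)" "child (Suc i) s b = q_a 0"
      using s by auto
    then show ?thesis using phi_related_A S_R False s(1) by simp
  qed
next
  case S_A
  then obtain t where t: "t < 2 ^ i" "s = (if i = 0 then q_c else q_a t)" "s' = q_a (2 * t)"
    using assms by (auto simp: phi_related_def)
  show ?thesis
  proof (cases b)
    case True
    then show ?thesis using S_A t by (auto simp: phi_related_def)
  next
    case False
    \<comment> \<open>One step around the cycle of length \<open>2 ^ i\<close> corresponds to two
      steps around the cycle of twice the length.\<close>
    have "Suc (Suc (2 * t) mod (2 * 2 ^ i)) mod (2 * 2 ^ i) = 2 * (Suc t mod 2 ^ i)"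
      by (simp add: mod_Suc_eq mult_mod_right)
    then show ?thesis using S_A t False
      by (auto simp: phi_related_def intro: exI[of _ "Suc t mod 2 ^ i"])
  qed
next
  case S_B
  then obtain t where t: "t < 2 ^ i" "s = child i (if i = 0 then q_c else q_a t) True" "s' = q_a (2 * t)"
    using assms by (auto simp: phi_related_def)
  \<comment> \<open>So the 0-edge from \<open>q_a (2 * t)\<close> reaches the next odd index without
    wrapping around.\<close>
  have lt: "Suc (2 * t) < 2 * 2 ^ i" using t(1) by linarith
  show ?thesis
  proof (cases "even t")
    case True
    then show ?thesis using S_B t lt
      by (cases b) (auto simp: phi_related_def k_index_Suc_double_even intro: exI[of _ 0])
  next
    case False
    then have "i > 0" using t(1) by (cases i) auto
    then show ?thesis using S_B t lt False k_index_odd(1,3)[OF False] k_index_odd(2)[OF False t(1)]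
      by (cases b) (auto simp: phi_related_def intro: exI[of _ "Suc (k_index t)"])
  qed
qed

lemma phi_related_run: "phi_related i (phi_state_at w) (run_A i w) (run_A (Suc i) (phi_output w))"
proof (induction w rule: rev_induct)
  case (snoc b w)
  then show ?case using phi_related_step[OF snoc, of b] by simp
qed (simp add: phi_related_def)

text \<open>In \<open>S_B\<close> the state \<open>s\<close> can be \<open>q_c\<close> for several
  even \<open>t\<close>, so it does not determine \<open>s'\<close> in general.\<close>

lemma phi_related_unique:
  assumes "phi_related i q s s'" "phi_related i q s s''" "q \<noteq> S_B"
  shows "s' = s''"
  using assms by (cases q) (auto simp: phi_related_def split: if_splits)

text \<open>Equal A_i-states therefore meet the hypothesis of \<open>T_phi_sync\<close>.\<close>

lemma phi_state_at_eq_S_L: "phi_state_at w = S_L \<longleftrightarrow> run_A i w \<in> {q_rho, q_ell}"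
  using phi_related_run[of i w]
  by (cases "phi_state_at w") (auto simp: phi_related_def split: if_splits)

abbreviation A_equiv :: "nat \<Rightarrow> bool list \<Rightarrow> bool list \<Rightarrow> bool" where
  "A_equiv i u v \<equiv> run_A i u = run_A i v"

text \<open>Equal transducer states transform the common tail in the same way, and surjectivity from
  that state makes every tail of the output arise.\<close>

lemma replaces_conj_phi:
  assumes "replaces f u v" "phi_state_at u = phi_state_at v" "phi_state_at u \<noteq> S_B"
  shows "replaces (conj_phi f) (phi_output u) (phi_output v)"
  unfolding replaces_def
proof
  fix z
  obtain z' where "z = transducer_map T_phi (phi_state_at u) z'"
    using surj_T_phi[OF assms(3)] by blast
  then have "phi_output u \<frown> z = phi (u \<frown> z')" "phi_output v \<frown> z = phi (v \<frown> z')"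
    using assms(2) by (simp_all add: phi_conc)
  then show "conj_phi f (phi_output u \<frown> z) = phi_output v \<frown> z"
    using assms(1) by (simp add: replaces_def)
qed

text \<open>Each piece is refined until both transducer runs agree outside \<open>S_B\<close>. Then
  it can be conjugated, and \<open>phi_related_unique\<close> turns equal A_i-states into equal
  A_(i+1)-states of the outputs.\<close>

lemma piecewise_conj_phi:
  assumes f: "piecewise (A_equiv i) f"
  shows "piecewise (A_equiv (Suc i)) (conj_phi f)"
  unfolding piecewise_def
proof
  fix x'
  obtain x where x: "x' = phi x" using surj_phi by blast
  obtain u v where uv: "x \<in> cylinder u" "replaces f u v" "run_A i u = run_A i v"
    using f unfolding piecewise_def by blast
  then obtain y where y: "x = u \<frown> y" by (auto simp: cylinder_iff)
  have "phi_state_at u = S_L \<longleftrightarrow> phi_state_at v = S_L"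
    using uv(3) phi_state_at_eq_S_L by metis
  then obtain n where n: "phi_state_at (u @ y [0 \<rightarrow> n]) = phi_state_at (v @ y [0 \<rightarrow> n])"
    "phi_state_at (u @ y [0 \<rightarrow> n]) \<noteq> S_B"
    by (rule T_phi_sync[of _ _ y]) simp
  define u' v' where "u' = u @ y [0 \<rightarrow> n]" and "v' = v @ y [0 \<rightarrow> n]"
  have f': "replaces f u' v'" unfolding u'_def v'_def using uv(2) by (rule replaces_append)
  have st: "phi_state_at u' = phi_state_at v'" "phi_state_at u' \<noteq> S_B"
    using n unfolding u'_def v'_def by auto
  have "replaces (conj_phi f) (phi_output u') (phi_output v')"
    using replaces_conj_phi f' st by blast
  moreover have "run_A i u' = run_A i v'" using uv(3) by (simp add: u'_def v'_def)
  then have "run_A (Suc i) (phi_output u') = run_A (Suc i) (phi_output v')"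
    using phi_related_run[of i u'] phi_related_run[of i v'] st phi_related_unique by metis
  moreover have "x \<in> cylinder u'" unfolding y u'_def by simp
  then have "x' \<in> cylinder (phi_output u')" 
    unfolding x cylinder_iff using phi_conc by blast
  ultimately show "\<exists>u v. x' \<in> cylinder u \<and> replaces (conj_phi f) u v \<and> A_equiv (Suc i) u v"
    by blast
qed

lemma conj_phi_thompson_F:
  assumes "f \<in> carrier thompson_F" "piecewise (A_equiv i) f"
  shows "conj_phi f \<in> carrier thompson_F"
proof -
  have f: "order_preserving f" "surj f" using assms by (auto simp: thompson_F_iff)
  have "order_preserving (conj_phi f)"
    unfolding conj_phi_def
    by (intro order_preserving_comp order_preserving_inv order_preserving_phi surj_phi f)
  moreover have "surj (conj_phi f)"
    unfolding conj_phi_def using f(2) surj_phi bij_phi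
    by (intro comp_surj) (auto simp: bij_imp_bij_inv bij_is_surj)
  moreover have "piecewise (\<lambda>_ _. True) (conj_phi f)"
    using piecewise_conj_phi[OF assms(2)] by (rule piecewise_mono) simp
  ultimately show ?thesis by (simp add: thompson_F_iff)
qed

text \<open>The two constant sequences are the least and the greatest element of the order.\<close>

lemma thompson_F_const:
  assumes "f \<in> carrier thompson_F"
  shows "f (\<lambda>_. b) = (\<lambda>_. b)"
proof -
  have f: "order_preserving f" "surj f" using assms by (auto simp: thompson_F_iff)
  obtain y where y: "f y = (\<lambda>_. b)" using f(2) by (metis surjD)
  have "\<not> less_fun x (\<lambda>_. False)" "\<not> less_fun (\<lambda>_. True) x" for x :: "bool word"
    by (auto simp: less_fun_def)
  then have "y = (\<lambda>_. b)"
    using y f(1) less_fun_linear[of y "\<lambda>_. b"] unfolding order_preserving_def by (metis (full_types))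
  then show ?thesis using y by simp
qed

lemma run_A_0:
  "run_A 0 w = (if w = [] then q_rho else if set w \<subseteq> {False} then q_ell
     else if set w \<subseteq> {True} then q_r else q_c)"
proof (induction w rule: rev_induct)
  case (snoc b w)
  have "\<not> (set w \<subseteq> {False} \<and> set w \<subseteq> {True})" if "w \<noteq> []"
    using that by (cases w) auto
  then show ?case using snoc by (cases "w = []"; cases b) (simp_all split: if_splits)
qed simp

lemma const_eq_conc_iff: "v \<frown> (\<lambda>_. b) = (\<lambda>_. b) \<longleftrightarrow> set v \<subseteq> {b}"
proof
  assume eq: "v \<frown> (\<lambda>_. b) = (\<lambda>_. b)"
  have "v ! n = b" if "n < length v" for n using fun_cong[OF eq, of n] that by simp
  then show "set v \<subseteq> {b}" by (auto simp: in_set_conv_nth)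
next
  assume v: "set v \<subseteq> {b}"
  then show "v \<frown> (\<lambda>_. b) = (\<lambda>_. b)"
    using build_first[of "\<lambda>_. b"] by (induction v) (auto simp: Omega_Words_Fun.suffix_def)
qed

text \<open>Because the constant sequences are fixed, a replacement and its inverse preserve being
  all 0 and being all 1. This is all that A_0 records, the empty word being the one with both
  properties.\<close>

lemma thompson_F_A_0:
  assumes "f \<in> carrier thompson_F"
  shows "piecewise (A_equiv 0) f"
proof -
  have 1: "set v \<subseteq> {b}"
    if f: "f \<in> carrier thompson_F" "replaces f u v" and u: "set u \<subseteq> {b}" for f u v b
  proof -
    have "f (u \<frown> (\<lambda>_. b)) = v \<frown> (\<lambda>_. b)" using f(2) by (simp add: replaces_def)
    moreover have "u \<frown> (\<lambda>_. b) = (\<lambda>_. b)" using u const_eq_conc_iff by metis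
    ultimately show ?thesis using thompson_F_const[OF f(1)] const_eq_conc_iff by metis
  qed
  have 2: "v = []" if f: "f \<in> carrier thompson_F" "replaces f [] v" for f v
    using 1[OF f, of False] 1[OF f, of True] by (cases v) auto
  have "run_A 0 u = run_A 0 v" if uv: "replaces f u v" for u v
  proof -
    have uv': "replaces (inv_into UNIV f) v u" 
      using uv assms thompson_F_bij bij_is_inj replaces_inv by blast
    have "set u \<subseteq> {b} \<longleftrightarrow> set v \<subseteq> {b}" for b
      using 1[OF assms uv, of b] 1[OF thompson_F_inv[OF assms] uv', of b] by argo
    moreover have "u = [] \<longleftrightarrow> v = []"
      using 2[OF assms, of v] 2[OF thompson_F_inv[OF assms], of u] uv uv' by auto
    ultimately show ?thesis unfolding run_A_0 by simp
  qed
  then show ?thesis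
    using assms unfolding thompson_F_iff piecewise_def by blast
qed

lemma F_conj_thompson_F:
  "f \<in> F_conj i \<Longrightarrow> f \<in> carrier thompson_F \<and> piecewise (A_equiv i) f"
proof (induction i arbitrary: f)
  case 0
  then show ?case using thompson_F_A_0 by (simp add: F_conj_0)
next
  case (Suc i)
  then show ?case using conj_phi_thompson_F piecewise_conj_phi unfolding F_conj_Suc by blast
qed

text \<open>Foldedness of A_i supplies the \<open>fold\<close> hypothesis of
  \<open>piecewise_replaces\<close>.\<close>

lemma A_equiv_if_replaces:
  assumes "piecewise (A_equiv i) f" "replaces f u v"
  shows "A_equiv i u v"
proof (rule piecewise_replaces[OF assms])
  fix u v assume "A_equiv i (u @ [False]) (v @ [False])" "A_equiv i (u @ [True]) (v @ [True])"
  then have "child i (run_A i u) b = child i (run_A i v) b" for b by (cases b) simp_all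
  then show "A_equiv i u v" using child_inject run_A_in_A_states by blast
qed simp

section \<open>The prefix equivalence of the conjugated group\<close>

lemma conj_phi_id: "conj_phi id = id"
  using surj_phi by (simp add: conj_phi_def fun_eq_iff surj_f_inv_f)

lemma conj_phi_comp: "conj_phi (f \<circ> g) = conj_phi f \<circ> conj_phi g"
  using bij_phi by (simp add: conj_phi_def fun_eq_iff bij_is_inj)

lemma conj_phi_inv:
  assumes "bij f"
  shows "conj_phi (inv_into UNIV f) = inv_into UNIV (conj_phi f)"
proof (rule inv_unique_comp[symmetric])
  have "f \<circ> inv_into UNIV f = id" "inv_into UNIV f \<circ> f = id"
    using assms by (simp_all add: bij_is_surj bij_is_inj flip: surj_iff)
  then show "conj_phi f \<circ> conj_phi (inv_into UNIV f) = id"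
    "conj_phi (inv_into UNIV f) \<circ> conj_phi f = id"
    by (simp_all only: conj_phi_id flip: conj_phi_comp)
qed

lemma F_conj_id: "id \<in> F_conj i"
proof (induction i)
  case 0
  show ?case unfolding F_conj_0 by (rule thompson_F_id)
next
  case (Suc i)
  then show ?case unfolding F_conj_Suc using conj_phi_id by (metis imageI)
qed

lemma F_conj_comp: "f \<in> F_conj i \<Longrightarrow> g \<in> F_conj i \<Longrightarrow> g \<circ> f \<in> F_conj i"
  by (induction i arbitrary: f g) (auto simp: F_conj_0 F_conj_Suc thompson_F_comp simp flip: conj_phi_comp)

lemma F_conj_bij: "f \<in> F_conj i \<Longrightarrow> bij f"
  using F_conj_thompson_F thompson_F_bij by blast

lemma F_conj_inv: "f \<in> F_conj i \<Longrightarrow> inv_into UNIV f \<in> F_conj i"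
proof (induction i arbitrary: f)
  case (Suc i)
  then obtain g where "f = conj_phi g" "g \<in> F_conj i" by (auto simp: F_conj_Suc)
  then show ?case using Suc.IH F_conj_bij conj_phi_inv unfolding F_conj_Suc by (metis imageI)
qed (simp add: F_conj_0 thompson_F_inv)

definition F_equiv :: "nat \<Rightarrow> bool list \<Rightarrow> bool list \<Rightarrow> bool" where
  "F_equiv i u v \<longleftrightarrow> (\<exists>f\<in>F_conj i. replaces f u v)"

lemma F_equiv_refl [simp]: "F_equiv i u u"
  unfolding F_equiv_def replaces_def using F_conj_id by (metis id_apply)

lemma F_equiv_sym: "F_equiv i u v \<Longrightarrow> F_equiv i v u"
  unfolding F_equiv_def using F_conj_inv F_conj_bij replaces_inv bij_is_inj by blast

lemma F_equiv_trans [trans]: "F_equiv i u v \<Longrightarrow> F_equiv i v w \<Longrightarrow> F_equiv i u w"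
  unfolding F_equiv_def using F_conj_comp replaces_comp by blast

lemma F_equiv_append: "F_equiv i u v \<Longrightarrow> F_equiv i (u @ t) (v @ t)"
  unfolding F_equiv_def using replaces_append by blast

lemma F_equiv_phi:
  assumes "F_equiv i u v" "phi_state_at u = q" "phi_state_at v = q" "q \<noteq> S_B"
  shows "F_equiv (Suc i) (phi_output u) (phi_output v)"
proof -
  obtain f where "f \<in> F_conj i" "replaces f u v" using assms(1) by (auto simp: F_equiv_def)
  then have "conj_phi f \<in> F_conj (Suc i)" "replaces (conj_phi f) (phi_output u) (phi_output v)"
    using assms replaces_conj_phi by (auto simp: F_conj_Suc)
  then show ?thesis by (auto simp: F_equiv_def)
qed

text \<open>The word leads to \<open>q_a t\<close> if \<open>0 < i\<close> and
  \<open>t < 2 ^ i\<close>. It takes the transducer to \<open>S_A\<close> with output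
  \<open>a_word (2 * t)\<close>, so these representatives suit the induction.\<close>

abbreviation a_word :: "nat \<Rightarrow> bool list" where
  "a_word t \<equiv> True # False # replicate t False"

lemma T_phi_replicate [simp]:
  "transducer_state T_phi S_A (replicate t False) = S_A"
  "transducer_output T_phi S_A (replicate t False) = replicate (2 * t) False"
  by (induction t) simp_all

text \<open>The words in \<open>state_word\<close> below span a tree in A_i, and each edge outside
  it contributes one relation. For \<open>i = 0\<close>, where \<open>q_c\<close> takes the place of
  the cyclic states, \<open>F_equiv_0\<close> is added separately, as it fails for larger
  \<open>i\<close>.\<close>

definition A_relations :: "nat \<Rightarrow> bool" where
  "A_relations i \<longleftrightarrow>
     F_equiv i [False] [False, False] \<and>
     F_equiv i [True] [True, True] \<and>
     F_equiv i [False, True] [False, True, True] \<and>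
     F_equiv i [False, True, False] (a_word 0) \<and>
     F_equiv i (a_word (2 ^ i)) (a_word 0) \<and>
     (\<forall>t<2 ^ i. even t \<longrightarrow> F_equiv i (a_word t @ [True]) [False, True]) \<and>
     (\<forall>t<2 ^ i. odd t \<longrightarrow> F_equiv i (a_word t @ [True]) (a_word (k_index t)))"

lemma F_equiv_0_plant:
  "replaces x_zero v w \<Longrightarrow> F_equiv 0 (u @ v) (u @ w)"
  unfolding F_equiv_def F_conj_0
  using replaces_plant_at thompson_F_plant_at thompson_F_x_zero by blast

lemma F_equiv_0: "F_equiv 0 [True, False] [False, True]"
  using F_equiv_0_plant[OF replaces_x_zero(2), of "[]"] by simp

text \<open>Every relation comes from pieces of \<open>x_zero\<close> planted at the empty word, at
  0 or at 1.\<close>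

lemma A_relations_0: "A_relations 0"
proof -
  have 1: "F_equiv 0 [False] [False, False]" "F_equiv 0 [True, True] [True]"
    using F_equiv_0_plant[OF replaces_x_zero(1), of "[]"] 
      F_equiv_0_plant[OF replaces_x_zero(3), of "[]"] by simp_all
  have 2: "F_equiv 0 [False, True, True] [False, True]"
    using F_equiv_0_plant[OF replaces_x_zero(3), of "[False]"] by simp
  have 3: "F_equiv 0 [True, False] [True, False, False]"
    using F_equiv_0_plant[OF replaces_x_zero(1), of "[True]"] by simp
  have 4: "F_equiv 0 [True, False, b] [False, True, b]" for b
    using F_equiv_append[OF F_equiv_0, of "[b]"] by simp
  have 5: "F_equiv 0 [False, True, False] [True, False]"
    using F_equiv_trans[OF 3 4] F_equiv_sym by blast
  have 6: "F_equiv 0 [True, False, True] [False, True]"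
    using F_equiv_trans[OF 4 2] by blast
  show ?thesis
    using 1 2 3 5 6 by (auto simp: A_relations_def intro: F_equiv_sym)
qed

text \<open>A single 1 after \<open>a_word s\<close> ends in \<open>S_B\<close>, so relations with
  two more letters are conjugated: 11 has output 1 and gives the even index \<open>2 * s\<close>,
  while 10 has output 01 and gives the odd index \<open>2 * s + 1\<close>.\<close>

lemma A_relations_Suc:
  assumes rel: "A_relations i"
  shows "A_relations (Suc i)"
proof -
  have c: "F_equiv i [False, True, True] [False, True]" and a0: "F_equiv i [False, True, False] (a_word 0)"
    using rel F_equiv_sym by (auto simp: A_relations_def)
  have even1: "F_equiv i (a_word t @ [True, b]) [False, True, b]" if "t < 2 ^ i" "even t" for t b
    using that rel F_equiv_append[of i "a_word t @ [True]" "[False, True]" "[b]"]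
    by (simp add: A_relations_def)
  have odd1: "F_equiv i (a_word t @ [True, b]) (a_word (k_index t) @ [b])" if "t < 2 ^ i" "odd t" for t b
    using that rel F_equiv_append[of i "a_word t @ [True]" "a_word (k_index t)" "[b]"]
    by (simp add: A_relations_def)
  have TT: "F_equiv i (a_word t @ [True, True]) [False, True]" if t: "t < 2 ^ i" for t
  proof (cases "even t")
    case True
    then show ?thesis using even1[OF t True] c F_equiv_trans by blast
  next
    case False
    have "F_equiv i (a_word (k_index t) @ [True]) [False, True]"
      using rel k_index_odd(1)[OF False] k_index_odd(2)[OF False t] by (simp add: A_relations_def)
    then show ?thesis using odd1[OF t False] F_equiv_trans by blast
  qed
  have TF: "F_equiv i (a_word t @ [True, False]) (a_word (if even t then 0 else Suc (k_index t)))"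
    if t: "t < 2 ^ i" for t
  proof (cases "even t")
    case True
    then show ?thesis using F_equiv_trans[OF even1[OF t True] a0] by simp
  next
    case False
    then show ?thesis using odd1[OF t False, of False] by (simp add: replicate_append_same)
  qed
  have "F_equiv (Suc i) (a_word t @ [True]) [False, True]" if "t < 2 ^ Suc i" "even t" for t
  proof -
    obtain s where s: "t = 2 * s" using \<open>even t\<close> by blast
    then have "F_equiv i (a_word s @ [True, True]) [False, True]" using TT that by simp
    from F_equiv_phi[OF this, of S_R] show ?thesis by (simp add: s)
  qed
  moreover have "F_equiv (Suc i) (a_word t @ [True]) (a_word (k_index t))"
    if "t < 2 ^ Suc i" "odd t" for t
  proof -
    obtain s where s: "t = Suc (2 * s)" using \<open>odd t\<close> by (auto elim: oddE)
    have k: "k_index t = 2 * (if even s then 0 else Suc (k_index s))"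
      using k_index_odd(3)[of s] k_index_Suc_double_even[of s] by (simp add: s)
    have "F_equiv i (a_word s @ [True, False]) (a_word (if even s then 0 else Suc (k_index s)))"
      using TF s that by simp
    from F_equiv_phi[OF this, of S_A]
    have "F_equiv (Suc i) (a_word (2 * s) @ [False, True]) (a_word (k_index t))"
      unfolding k by simp
    moreover have "a_word t = a_word (2 * s) @ [False]" by (simp add: s replicate_append_same)
    ultimately show ?thesis by simp
  qed
  moreover have "F_equiv (Suc i) [False] [False, False]" "F_equiv (Suc i) [True] [True, True]"
    "F_equiv (Suc i) [False, True] [False, True, True]"
    using rel F_equiv_phi[of i "[False]" "[False, False]" S_L] F_equiv_phi[of i "[True]" "[True, True]" S_R]
      F_equiv_phi[of i "[False, True]" "[False, True, True]" S_R]
    by (simp_all add: A_relations_def)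
  moreover have "F_equiv (Suc i) [False, True, False] (a_word 0)"
    using F_equiv_phi[OF a0, of S_A] by simp
  moreover have "F_equiv (Suc i) (a_word (2 ^ Suc i)) (a_word 0)"
  proof -
    have "F_equiv i (a_word (2 ^ i)) (a_word 0)" using rel by (simp add: A_relations_def)
    from F_equiv_phi[OF this, of S_A] show ?thesis by simp
  qed
  ultimately show ?thesis unfolding A_relations_def by blast
qed

lemma A_relations: "A_relations i"
  by (induction i) (rule A_relations_0, rule A_relations_Suc)

fun state_word :: "a_state \<Rightarrow> bool list" where
  "state_word q_rho = []"
| "state_word q_ell = [False]"
| "state_word q_r = [True]"
| "state_word q_c = [False, True]"
| "state_word (q_a t) = a_word t"

text \<open>Edges of the spanning tree give reflexivity and the others are listed in
  \<open>A_relations\<close>; \<open>F_equiv_0\<close> settles the 0-child of \<open>q_r\<close> at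
  level 0.\<close>

lemma F_equiv_state_word_child:
  assumes "s \<in> A_states i"
  shows "F_equiv i (state_word s @ [b]) (state_word (child i s b))"
proof (cases s)
  case q_rho
  then show ?thesis by (cases b) simp_all
next
  case q_ell
  then show ?thesis using A_relations[of i] by (cases b) (auto simp: A_relations_def intro: F_equiv_sym)
next
  case q_r
  then show ?thesis using A_relations[of i] F_equiv_0
    by (cases b) (auto simp: A_relations_def intro: F_equiv_sym)
next
  case q_c
  have "F_equiv 0 [False, True, False] [False, True]"
    using A_relations[of 0] F_equiv_trans[OF _ F_equiv_0] by (simp add: A_relations_def)
  then show ?thesis using q_c A_relations[of i]
    by (cases b) (auto simp: A_relations_def intro: F_equiv_sym)
next
  case (q_a t)
  then have t: "t < 2 ^ i" using assms by (auto simp: A_states_def split: if_splits)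
  show ?thesis
  proof (cases b)
    case True
    then show ?thesis using q_a t A_relations[of i] by (auto simp: A_relations_def)
  next
    case False
    show ?thesis
    proof (cases "Suc t < 2 ^ i")
      case True
      then show ?thesis using q_a False by (simp add: replicate_append_same)
    next
      case last: False
      then have "Suc t = 2 ^ i" using t by simp
      moreover have "a_word t @ [False] = a_word (Suc t)" by (simp add: replicate_append_same)
      ultimately have "F_equiv i (a_word t @ [False]) (a_word 0)"
        using A_relations[of i] by (simp only: A_relations_def)
      then show ?thesis using q_a False \<open>Suc t = 2 ^ i\<close> by simp
    qed
  qed
qed

lemma F_equiv_state_word: "F_equiv i w (state_word (run_A i w))"
proof (induction w rule: rev_induct)
  case (snoc b w)
  show ?case
    using F_equiv_trans[OF F_equiv_append[OF snoc, of "[b]"]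
        F_equiv_state_word_child[OF run_A_in_A_states, of i w b]]
    by simp
qed simp

text \<open>Left to right, elements of H_i preserve A_i-states; right to left, both words are
  equivalent to the representative of their common state.\<close>

lemma F_equiv_iff: "F_equiv i u v \<longleftrightarrow> A_equiv i u v"
proof
  show "A_equiv i u v" if "F_equiv i u v"
    using that F_conj_thompson_F A_equiv_if_replaces unfolding F_equiv_def by blast
  show "F_equiv i u v" if "A_equiv i u v"
    using that F_equiv_state_word F_equiv_sym F_equiv_trans by metis
qed

lemma run_A_state_word:
  assumes "s \<in> A_states i"
  shows "run_A i (state_word s) = s"
proof -
  have "run_A i (a_word t) = q_a t" if "t < 2 ^ i" "i > 0" for t
    using that(1)
  proof (induction t)
    case (Suc t)
    have "a_word (Suc t) = a_word t @ [False]" by (simp add: replicate_append_same)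
    then have "run_A i (a_word (Suc t)) = child i (run_A i (a_word t)) False"
      by (simp only: foldl_append foldl.simps)
    then show ?case using Suc by simp
  qed (use that(2) in simp)
  then show ?thesis using assms by (cases s) (auto simp: A_states_def split: if_splits)
qed

text \<open>For the induction step, an element supported in a cylinder that \<open>phi\<close> maps
  into \<open>cylinder w\<close> is conjugated by \<open>phi\<close>.\<close>

lemma ex_F_conj_supported:
  "\<exists>g\<in>F_conj i. g \<noteq> id \<and> (\<forall>x. x \<notin> cylinder w \<longrightarrow> g x = x)"
proof (induction i arbitrary: w)
  case 0
  have "plant_at w x_zero (w \<frown> (True ## False ## x)) = w \<frown> (False ## True ## x)" for x
    by (simp add: plant_at_conc)
  moreover have "w \<frown> (True ## False ## x) \<noteq> w \<frown> (False ## True ## x)" for x by simp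
  ultimately have "plant_at w x_zero \<noteq> id" by (metis id_apply)
  then show ?case
    unfolding F_conj_0 using thompson_F_plant_at thompson_F_x_zero plant_at_outside by blast
next
  case (Suc i)
  obtain y where y: "phi y \<in> cylinder w"
    using surjD[OF surj_phi, of "w \<frown> undefined"] conc_in_cylinder[of w undefined] by metis
  \<comment> \<open>The output outgrows \<open>w\<close>; since both are initial segments of
    \<open>phi y\<close>, it extends \<open>w\<close>.\<close>
  obtain n where n: "length w < length (phi_output (y [0 \<rightarrow> n]))"
    using T_phi.output_unbounded by blast
  define u where "u = y [0 \<rightarrow> n]"
  have "phi y \<in> cylinder (phi_output u)"
    unfolding phi_def u_def by (rule T_phi.transducer_map_cylinder)
  then have pre: "Sublist.prefix w (phi_output u)"
    using y n cylinder_comparable u_def prefix_length_le leD by metis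
  obtain g where g: "g \<in> F_conj i" "g \<noteq> id" "\<And>x. x \<notin> cylinder u \<Longrightarrow> g x = x"
    using Suc by metis
  have "phi x \<in> cylinder w" if "x \<in> cylinder u" for x
  proof -
    obtain z where "x = u \<frown> z" using \<open>x \<in> cylinder u\<close> unfolding cylinder_iff by blast
    then have "phi x \<in> cylinder (phi_output u)" by (simp add: phi_conc)
    then show ?thesis using pre by (rule in_cylinder_prefix)
  qed
  then have "conj_phi g x = x" if "x \<notin> cylinder w" for x
    using that g(3) surj_phi by (metis conj_phi_phi surjD)
  moreover have "conj_phi g \<noteq> id"
    using g(2) bij_phi by (metis bij_is_inj conj_phi_phi eq_id_iff injD)
  ultimately show ?case unfolding F_conj_Suc using g(1) by blast
qed

section \<open>The core\<close>

fun path :: "'v automaton \<Rightarrow> 'v \<Rightarrow> bool list \<Rightarrow> 'v \<Rightarrow> bool" where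
  "path X p [] q \<longleftrightarrow> p = q"
| "path X p (b # w) q \<longleftrightarrow> (\<exists>r. (p, b, r) \<in> edges X \<and> path X r w q)"

lemma path_append: "path X p (u @ v) q \<longleftrightarrow> (\<exists>r. path X p u r \<and> path X r v q)"
  by (induction u arbitrary: p) auto

lemma path_unique: "deterministic X \<Longrightarrow> path X p w q \<Longrightarrow> path X p w q' \<Longrightarrow> q = q'"
  by (induction w arbitrary: p) (auto simp: deterministic_def, metis)

text \<open>Both words must be readable, so reflexivity at a word expresses its readability.\<close>

definition leads_to_same :: "'v automaton \<Rightarrow> bool list \<Rightarrow> bool list \<Rightarrow> bool" where
  "leads_to_same X u v \<longleftrightarrow> (\<exists>q. path X (root_state X) u q \<and> path X (root_state X) v q)"

lemma leads_to_same_sym: "leads_to_same X u v \<Longrightarrow> leads_to_same X v u"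
  by (auto simp: leads_to_same_def)

text \<open>Readability of \<open>u @ t\<close> comes from that of \<open>v @ t\<close>, because
  \<open>u\<close> and \<open>v\<close> reach the same state.\<close>

lemma leads_to_same_trans_append:
  assumes "deterministic X" "leads_to_same X u v" "leads_to_same X (v @ t) w"
  shows "leads_to_same X (u @ t) w"
proof -
  obtain q where q: "path X (root_state X) u q" "path X (root_state X) v q"
    using assms(2) by (auto simp: leads_to_same_def)
  obtain r where r: "path X (root_state X) (v @ t) r" "path X (root_state X) w r"
    using assms(3) by (auto simp: leads_to_same_def)
  then have "path X q t r" using q(2) path_unique[OF assms(1)] by (metis path_append)
  then show ?thesis using q(1) r(2) by (auto simp: leads_to_same_def path_append)
qed

lemma piecewise_generate:
  assumes det: "deterministic X" and gen: "generate thompson_F S \<subseteq> carrier thompson_F"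
    and S: "\<And>s. s \<in> S \<Longrightarrow> piecewise (leads_to_same X) s"
    and f: "f \<in> generate thompson_F S"
  shows "piecewise (leads_to_same X) f"
  using f
proof induction
  case one
  show ?case by (simp only: thompson_F_one, rule piecewise_id) (simp add: leads_to_same_def)
next
  case (incl h)
  then show ?case using S by blast
next
  case (inv h)
  then have h: "h \<in> carrier thompson_F" using generate.incl[of h S thompson_F] gen by (meson subsetD)
  show ?case
    unfolding thompson_F_m_inv[OF h]
    using thompson_F_bij[OF h] S[OF inv] leads_to_same_sym by (rule piecewise_inv)
next
  case (eng h1 h2)
  show ?case
    unfolding thompson_F_mult
  \<comment> \<open>The product is composition of functions, so \<open>h2\<close> acts
    first.\<close>
  proof (rule piecewise_comp[OF eng.IH(2,1)])
    fix u v w t assume "leads_to_same X u v" "leads_to_same X (v @ t) w"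
    then show "leads_to_same X (u @ t) w" using leads_to_same_trans_append[OF det] by blast
  next
    fix u v w t assume "leads_to_same X u (v @ t)" "leads_to_same X v w"
    then show "leads_to_same X u (w @ t)"
      using leads_to_same_trans_append[OF det] leads_to_same_sym by blast
  qed
qed

text \<open>
  An element supported in \<open>cylinder w\<close> but different from the identity cannot replace \<open>w\<close>
  or any prefix of it, so its pieces inside the cylinder are read along paths through \<open>w\<close>.
\<close>

lemma path_exists_if_piecewise:
  assumes all: "\<And>f. f \<in> F_conj i \<Longrightarrow> piecewise (leads_to_same X) f"
  shows "\<exists>q. path X (root_state X) w q"
proof -
  obtain g where g: "g \<in> F_conj i" "g \<noteq> id" "\<And>x. x \<notin> cylinder w \<Longrightarrow> g x = x"
    using ex_F_conj_supported[of i w] by blast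
  have "bij g" using g(1) by (rule F_conj_bij)
  obtain x where x: "g x \<noteq> x" using g(2) by (auto simp: fun_eq_iff)
  then have "x \<in> cylinder w" using g(3) by blast
  obtain u v where uv: "x \<in> cylinder u" "replaces g u v" "leads_to_same X u v"
    using all[OF g(1)] unfolding piecewise_def by blast
  have "\<not> Sublist.prefix u w"
  proof
    assume "Sublist.prefix u w"
    then obtain t where t: "w = u @ t" by (auto simp: Sublist.prefix_def)
    have rep: "replaces g w (v @ t)" unfolding t using uv(2) by (rule replaces_append)
    \<comment> \<open>As \<open>g\<close> is bijective and fixes the complement of
      \<open>cylinder w\<close>, it maps this cylinder onto itself; a prefix replacement on it is
      then trivial.\<close>
    have "cylinder (v @ t) = cylinder w"
    proof (intro equalityI subsetI)
      fix y assume "y \<in> cylinder (v @ t)"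
      then obtain z where y: "y = g (w \<frown> z)"
        using rep unfolding cylinder_iff replaces_def by metis
      show "y \<in> cylinder w"
      proof (rule ccontr)
        assume "y \<notin> cylinder w"
        then have "g y = g (w \<frown> z)" using g(3) y by simp
        then have "y = w \<frown> z" using \<open>bij g\<close> by (meson bij_is_inj injD)
        then show False using \<open>y \<notin> cylinder w\<close> by simp
      qed
    next
      fix y assume y: "y \<in> cylinder w"
      obtain z where z: "y = g z" using \<open>bij g\<close> by (meson bij_pointE)
      have "z \<in> cylinder w" using g(3)[of z] y z by metis
      then show "y \<in> cylinder (v @ t)"
        using rep z unfolding cylinder_iff replaces_def by metis
    qed
    then have "v @ t = w" by (rule cylinder_inject)
    then show False
      using rep \<open>x \<in> cylinder w\<close> x unfolding cylinder_iff replaces_def by metis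
  qed
  then have "Sublist.prefix w u" using cylinder_comparable[OF uv(1) \<open>x \<in> cylinder w\<close>] by blast
  then obtain t where "u = w @ t" by (auto simp: Sublist.prefix_def)
  then show ?thesis using uv(3) by (auto simp: leads_to_same_def path_append)
qed

text \<open>Readability of all words makes the relation closed under appending, and foldedness
  allows going back to parents, so \<open>piecewise_replaces\<close> applies.\<close>

lemma leads_to_same_if_F_equiv:
  assumes "deterministic X" "folded X"
    and all: "\<And>f. f \<in> F_conj i \<Longrightarrow> piecewise (leads_to_same X) f"
    and uv: "F_equiv i u v"
  shows "leads_to_same X u v"
proof -
  have total: "\<exists>q. path X (root_state X) w q" for w
    using all by (rule path_exists_if_piecewise)
  obtain f where "f \<in> F_conj i" "replaces f u v" using uv by (auto simp: F_equiv_def)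
  then have "piecewise (leads_to_same X) f" using all by blast
  then show ?thesis
  proof (rule piecewise_replaces[OF _ \<open>replaces f u v\<close>])
    fix u v t assume "leads_to_same X u v"
    moreover obtain q where "path X (root_state X) (v @ t) q" using total by blast
    then have "leads_to_same X (v @ t) (v @ t)" by (auto simp: leads_to_same_def)
    ultimately show "leads_to_same X (u @ t) (v @ t)"
      using leads_to_same_trans_append assms(1) by blast
  next
    fix u v assume *: "leads_to_same X (u @ [False]) (v @ [False])"
      "leads_to_same X (u @ [True]) (v @ [True])"
    obtain p q where p: "path X (root_state X) u p" and q: "path X (root_state X) v q"
      using total by blast
    have "\<exists>r. (p, b, r) \<in> edges X \<and> (q, b, r) \<in> edges X"
      if "leads_to_same X (u @ [b]) (v @ [b])" for b
      using that p q path_unique[OF assms(1)] by (auto simp: leads_to_same_def path_append) metis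
    then have "p = q" using * assms(2) unfolding folded_def by metis
    then show "leads_to_same X u v" using p q by (auto simp: leads_to_same_def)
  qed
qed

text \<open>States are classes of words leading to them, and the two automata induce the same
  classes. By \<open>same\<close>, the word chosen in \<open>h\<close> does not matter.\<close>

lemma automaton_isomorphic_A:
  assumes det: "deterministic X"
    and root: "root_state X \<in> states X"
    and closed: "\<And>p b q. (p, b, q) \<in> edges X \<Longrightarrow> p \<in> states X \<and> q \<in> states X"
    and reach: "\<And>p. p \<in> states X \<Longrightarrow> \<exists>w. path X (root_state X) w p"
    and total: "\<And>w. \<exists>p. path X (root_state X) w p"
    and same: "\<And>u v. leads_to_same X u v \<longleftrightarrow> A_equiv i u v"
  shows "automaton_isomorphic X (\<A> i)"
proof -
  define h where "h p = run_A i (SOME w. path X (root_state X) w p)" for p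
  have h: "h p = run_A i w" if "path X (root_state X) w p" for p w
  proof -
    have "path X (root_state X) (SOME w. path X (root_state X) w p) p"
      using that by (rule someI)
    then show ?thesis using that same unfolding h_def leads_to_same_def by blast
  qed
  have in_states: "p \<in> states X" if "path X (root_state X) w p" for w p
    using that root closed by (cases w rule: rev_cases) (auto simp: path_append)
  have h_inj: "p = q" if pq: "p \<in> states X" "q \<in> states X" "h p = h q" for p q
  proof -
    obtain u v where uv: "path X (root_state X) u p" "path X (root_state X) v q"
      using reach pq by blast
    then have "leads_to_same X u v" using h pq(3) same by metis
    then show ?thesis using uv path_unique[OF det] by (metis leads_to_same_def)
  qed
  have edge: "h q = child i (h p) b" if e: "(p, b, q) \<in> edges X" for p b q
  proof -
    obtain w where w: "path X (root_state X) w p" using reach closed e by blast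
    then have "path X (root_state X) (w @ [b]) q" using e by (auto simp: path_append)
    then show ?thesis using h w by fastforce
  qed
  have h_states: "h p \<in> A_states i" for p
    unfolding h_def by (rule run_A_in_A_states)
  have "bij_betw h (states X) (A_states i)"
    unfolding bij_betw_def
  proof (intro conjI inj_onI equalityI subsetI)
    fix s assume s: "s \<in> A_states i"
    obtain p where p: "path X (root_state X) (state_word s) p" using total by blast
    then have "h p = s" using h s run_A_state_word by simp
    then show "s \<in> h ` states X" using in_states p by blast
  qed (use h_inj h_states in auto)
  moreover have "h (root_state X) = q_rho" using h[of "[]"] by simp
  moreover have "(p, b, q) \<in> edges X \<longleftrightarrow> h q = child i (h p) b"
    if pq: "p \<in> states X" "q \<in> states X" for p q b
  proof
    assume eq: "h q = child i (h p) b"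
    obtain w where w: "path X (root_state X) w p" using reach pq by blast
    obtain q' where "path X (root_state X) (w @ [b]) q'" using total by blast
    \<comment> \<open>Totality provides some edge labelled \<open>b\<close> at \<open>p\<close>;
      injectivity of \<open>h\<close> identifies its target with \<open>q\<close>.\<close>
    then have e: "(p, b, q') \<in> edges X" using w path_unique[OF det] by (auto simp: path_append)
    then have "q' = q" using h_inj closed edge eq pq(2) by metis
    then show "(p, b, q) \<in> edges X" using e by simp
  qed (rule edge)
  ultimately show ?thesis
    unfolding automaton_isomorphic_def A_automaton using h_states by (intro exI[of _ h]) auto
qed

section \<open>The folding relation as the least admissible equivalence\<close>

definition admissible :: "'v automaton \<Rightarrow> ('v \<times> 'v) set \<Rightarrow> ('v \<times> 'v) set \<Rightarrow> bool" where
  "admissible G R E \<longleftrightarrow> equiv (states G) E \<and> R \<subseteq> E \<and>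
     deterministic (quotient_automaton G E) \<and> folded (quotient_automaton G E)"

locale closed_automaton =
  fixes G :: "'v automaton"
  assumes edges_closed: "(p, b, q) \<in> edges G \<Longrightarrow> p \<in> states G \<and> q \<in> states G"
begin

lemma deterministic_quotient_iff:
  assumes E: "equiv (states G) E"
  shows "deterministic (quotient_automaton G E) \<longleftrightarrow>
    (\<forall>p b q p' q'. (p, b, q) \<in> edges G \<longrightarrow> (p', b, q') \<in> edges G \<longrightarrow> (p, p') \<in> E \<longrightarrow> (q, q') \<in> E)"
    (is "?l \<longleftrightarrow> ?r")
proof
  assume l: ?l
  show ?r
  proof (intro allI impI)
    fix p b q p' q' assume e: "(p, b, q) \<in> edges G" "(p', b, q') \<in> edges G" "(p, p') \<in> E"
    then have "(E `` {p}, b, E `` {q}) \<in> edges (quotient_automaton G E)"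
      "(E `` {p'}, b, E `` {q'}) \<in> edges (quotient_automaton G E)"
      by (auto simp: quotient_automaton_def)
    moreover have "E `` {p} = E `` {p'}" using E e(3) by (rule equiv_class_eq)
    ultimately have "E `` {q} = E `` {q'}" using l unfolding deterministic_def by metis
    then show "(q, q') \<in> E" using E edges_closed e eq_equiv_class by metis
  qed
next
  assume r: ?r
  show ?l
    unfolding deterministic_def
  proof (intro allI impI)
    fix P b Q Q' assume "(P, b, Q) \<in> edges (quotient_automaton G E)"
      "(P, b, Q') \<in> edges (quotient_automaton G E)"
    then obtain p q p' q' where e: "(p, b, q) \<in> edges G" "(p', b, q') \<in> edges G"
      "P = E `` {p}" "P = E `` {p'}" "Q = E `` {q}" "Q' = E `` {q'}"
      by (auto simp: quotient_automaton_def)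
    then have "(p, p') \<in> E" using E edges_closed eq_equiv_class by metis
    then have "(q, q') \<in> E" using r e by blast
    then show "Q = Q'" using E e equiv_class_eq by metis
  qed
qed

text \<open>The two edges at a father class may start at different representatives, hence
  \<open>p\<close> and \<open>p'\<close>. Like determinism, the condition is an implication between
  memberships in \<open>E\<close>, so it survives intersections.\<close>

lemma folded_quotient_iff:
  assumes E: "equiv (states G) E"
  shows "folded (quotient_automaton G E) \<longleftrightarrow>
    (\<forall>p p' q q' c c' d d'. (p, False, c) \<in> edges G \<longrightarrow> (p', True, d) \<in> edges G \<longrightarrow>
       (q, False, c') \<in> edges G \<longrightarrow> (q', True, d') \<in> edges G \<longrightarrow>
       (p, p') \<in> E \<longrightarrow> (q, q') \<in> E \<longrightarrow> (c, c') \<in> E \<longrightarrow> (d, d') \<in> E \<longrightarrow> (p, q) \<in> E)"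
    (is "?l \<longleftrightarrow> ?r")
proof
  assume l: ?l
  show ?r
  proof (intro allI impI)
    fix p p' q q' c c' d d'
    assume e: "(p, False, c) \<in> edges G" "(p', True, d) \<in> edges G"
      "(q, False, c') \<in> edges G" "(q', True, d') \<in> edges G"
      and E': "(p, p') \<in> E" "(q, q') \<in> E" "(c, c') \<in> E" "(d, d') \<in> E"
    have "(E `` {p}, False, E `` {c}) \<in> edges (quotient_automaton G E)"
      "(E `` {p'}, True, E `` {d}) \<in> edges (quotient_automaton G E)"
      "(E `` {q}, False, E `` {c'}) \<in> edges (quotient_automaton G E)"
      "(E `` {q'}, True, E `` {d'}) \<in> edges (quotient_automaton G E)"
      using e by (auto simp: quotient_automaton_def)
    moreover have "E `` {p} = E `` {p'}" "E `` {q} = E `` {q'}" "E `` {c} = E `` {c'}"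
      "E `` {d} = E `` {d'}"
      using equiv_class_eq[OF E] E' by blast+
    ultimately have "E `` {p} = E `` {q}" using l unfolding folded_def by metis
    then show "(p, q) \<in> E" using E edges_closed e eq_equiv_class by metis
  qed
next
  assume r: ?r
  show ?l
    unfolding folded_def
  proof (intro allI impI)
    fix P Q C D
    assume "(P, False, C) \<in> edges (quotient_automaton G E)"
      "(P, True, D) \<in> edges (quotient_automaton G E)"
      "(Q, False, C) \<in> edges (quotient_automaton G E)"
      "(Q, True, D) \<in> edges (quotient_automaton G E)"
    then obtain p p' q q' c c' d d' where e: "(p, False, c) \<in> edges G" "(p', True, d) \<in> edges G"
      "(q, False, c') \<in> edges G" "(q', True, d') \<in> edges G"
      and cl: "P = E `` {p}" "P = E `` {p'}" "Q = E `` {q}" "Q = E `` {q'}"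
      "C = E `` {c}" "C = E `` {c'}" "D = E `` {d}" "D = E `` {d'}"
      unfolding quotient_automaton_def by auto
    have "(p, p') \<in> E" "(q, q') \<in> E" "(c, c') \<in> E" "(d, d') \<in> E"
      using E edges_closed e cl eq_equiv_class by metis+
    then have "(p, q) \<in> E" using r e by blast
    then show "P = Q" using E cl equiv_class_eq by metis
  qed
qed

text \<open>The witness \<open>E0\<close> keeps the intersection from ranging over an empty family,
  which would give the universal relation.\<close>

lemma folding_relation_admissible:
  assumes "admissible G R E0"
  shows "admissible G R (folding_relation G R)"
proof -
  let ?F = "folding_relation G R"
  have F: "?F = \<Inter> {E. admissible G R E}"
    by (simp add: folding_relation_def admissible_def)
  have mem: "(x, y) \<in> ?F \<longleftrightarrow> (\<forall>E. admissible G R E \<longrightarrow> (x, y) \<in> E)" for x y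
    unfolding F by blast
  have eqv: "equiv (states G) E" if "admissible G R E" for E
    using that by (simp add: admissible_def)
  have equiv: "equiv (states G) ?F"
  proof (rule equivI)
    show "?F \<subseteq> states G \<times> states G"
      using eqv[OF assms] assms unfolding F equiv_def by blast
    show "refl_on (states G) ?F"
      using eqv unfolding refl_on_def mem equiv_def by blast
    show "sym ?F" using eqv unfolding sym_def mem equiv_def by blast
    show "trans ?F" using eqv unfolding trans_def mem equiv_def by blast
  qed
  moreover have "R \<subseteq> ?F" unfolding F admissible_def by blast
  moreover have "deterministic (quotient_automaton G ?F)"
    unfolding deterministic_quotient_iff[OF equiv] mem
    using deterministic_quotient_iff[OF eqv] unfolding admissible_def by meson
  moreover have "folded (quotient_automaton G ?F)"
    unfolding folded_quotient_iff[OF equiv] mem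
  proof (intro allI impI)
    fix p p' q q' c c' d d' E
    assume e: "(p, False, c) \<in> edges G" "(p', True, d) \<in> edges G"
      "(q, False, c') \<in> edges G" "(q', True, d') \<in> edges G"
      and E': "\<forall>E. admissible G R E \<longrightarrow> (p, p') \<in> E" "\<forall>E. admissible G R E \<longrightarrow> (q, q') \<in> E"
      "\<forall>E. admissible G R E \<longrightarrow> (c, c') \<in> E" "\<forall>E. admissible G R E \<longrightarrow> (d, d') \<in> E"
      and E: "admissible G R E"
    have "folded (quotient_automaton G E)" using E by (simp add: admissible_def)
    moreover have "(p, p') \<in> E" "(q, q') \<in> E" "(c, c') \<in> E" "(d, d') \<in> E" using E E' by blast+
    ultimately show "(p, q) \<in> E"
      using folded_quotient_iff[OF eqv[OF E]] e by blast
  qed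
  ultimately show ?thesis by (simp add: admissible_def)
qed

end

lemma folding_relation_least: "admissible G R E \<Longrightarrow> folding_relation G R \<subseteq> E"
  unfolding folding_relation_def admissible_def by blast

section \<open>The tree graph and its map to A_i\<close>

lemma tree_words_prefix: "w \<in> tree_words s \<sigma> \<Longrightarrow> Sublist.prefix v w \<Longrightarrow> v \<in> tree_words s \<sigma>"
  unfolding tree_words_def using prefix_order.trans by blast

interpretation tree_graph: closed_automaton "tree_graph S" for S
proof
  fix p b q assume "(p, b, q) \<in> edges (tree_graph S)"
  then obtain s \<sigma> w where e: "p = vertex s \<sigma> w" "q = vertex s \<sigma> (w @ [b])" "s \<in> S"
    "w @ [b] \<in> tree_words s \<sigma>"
    by (auto simp: tree_graph_def)
  moreover have "w \<in> tree_words s \<sigma>" using tree_words_prefix[OF e(4), of w] by simp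
  ultimately show "p \<in> states (tree_graph S) \<and> q \<in> states (tree_graph S)"
    by (auto simp: tree_graph_def)
qed

fun vertex_word :: "vertex \<Rightarrow> bool list" where
  "vertex_word Root = []"
| "vertex_word (Node s \<sigma> w) = w"

lemma vertex_word [simp]: "vertex_word (vertex s \<sigma> w) = w"
  by (simp add: vertex_def)

lemma tree_graph_edge_word:
  "(p, b, q) \<in> edges (tree_graph S) \<Longrightarrow> vertex_word q = vertex_word p @ [b]"
  by (auto simp: tree_graph_def)

definition A_kernel :: "nat \<Rightarrow> (bool word \<Rightarrow> bool word) set \<Rightarrow> (vertex \<times> vertex) set" where
  "A_kernel i S = {(p, q). p \<in> states (tree_graph S) \<and> q \<in> states (tree_graph S) \<and>
     A_equiv i (vertex_word p) (vertex_word q)}"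

text \<open>Glued leaves are replaced by one another under an element of H_i, so their A_i-states
  agree; determinism holds because a state determines its children, and foldedness is
  \<open>child_inject\<close>.\<close>

lemma A_kernel_admissible:
  assumes S: "S \<subseteq> F_conj i"
  shows "admissible (tree_graph S) (leaf_gluing S) (A_kernel i S)"
proof -
  have equiv: "equiv (states (tree_graph S)) (A_kernel i S)"
    by (auto intro!: equivI simp: A_kernel_def refl_on_def sym_def trans_def)
  have "leaf_gluing S \<subseteq> A_kernel i S"
  proof (clarify)
    fix p q assume "(p, q) \<in> leaf_gluing S"
    then obtain s us vs j where pq: "p = vertex s T_plus (us ! j)" "q = vertex s T_minus (vs ! j)"
      "s \<in> S" "reduced_tree_diagram s us vs" "j < length us"
      by (auto simp: leaf_gluing_def)
    have len: "j < length vs" using pq by (simp add: reduced_tree_diagram_def tree_diagram_def)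
    have "us ! j \<in> tree_words s T_plus" "vs ! j \<in> tree_words s T_minus"
      unfolding tree_words_def using pq(4,5) len by (auto intro!: exI bexI[OF _ nth_mem])
    moreover have "replaces s (us ! j) (vs ! j)"
      using pq by (auto simp: reduced_tree_diagram_def represents_def replaces_def)
    then have "A_equiv i (us ! j) (vs ! j)"
      using A_equiv_if_replaces F_conj_thompson_F S pq(3) by blast
    ultimately show "(p, q) \<in> A_kernel i S" using pq(1-3) by (auto simp: A_kernel_def tree_graph_def)
  qed
  moreover have "deterministic (quotient_automaton (tree_graph S) (A_kernel i S))"
    unfolding tree_graph.deterministic_quotient_iff[OF equiv]
    using tree_graph.edges_closed[of _ _ _ S]
    by (fastforce simp: A_kernel_def dest: tree_graph_edge_word)
  moreover have "folded (quotient_automaton (tree_graph S) (A_kernel i S))"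
    unfolding tree_graph.folded_quotient_iff[OF equiv]
  proof (intro allI impI)
    fix p p' q q' c c' d d'
    assume e: "(p, False, c) \<in> edges (tree_graph S)" "(p', True, d) \<in> edges (tree_graph S)"
      "(q, False, c') \<in> edges (tree_graph S)" "(q', True, d') \<in> edges (tree_graph S)"
      and k: "(p, p') \<in> A_kernel i S" "(q, q') \<in> A_kernel i S" "(c, c') \<in> A_kernel i S"
      "(d, d') \<in> A_kernel i S"
    have "child i (run_A i (vertex_word p)) b = child i (run_A i (vertex_word q)) b" for b
      using e[THEN tree_graph_edge_word] k by (cases b) (auto simp: A_kernel_def)
    then have "A_equiv i (vertex_word p) (vertex_word q)"
      using child_inject run_A_in_A_states by blast
    then show "(p, q) \<in> A_kernel i S" using k by (simp add: A_kernel_def)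
  qed
  ultimately show ?thesis using equiv by (simp add: admissible_def)
qed

theorem proposition6p2:
  fixes i :: nat and S :: "(bool word \<Rightarrow> bool word) set"
  assumes "generate thompson_F S = F_conj i"
  shows "automaton_isomorphic (core S) (\<A> i)"
proof -
  let ?G = "tree_graph S"
  let ?E = "folding_relation ?G (leaf_gluing S)"
  have S: "S \<subseteq> F_conj i" using generate.incl[of _ S thompson_F] unfolding assms by (rule subsetI)
  have kernel: "?E \<subseteq> A_kernel i S"
    using A_kernel_admissible[OF S] by (rule folding_relation_least)
  have adm: "admissible ?G (leaf_gluing S) ?E"
    using A_kernel_admissible[OF S] by (rule tree_graph.folding_relation_admissible)
  have equiv: "equiv (states ?G) ?E" and det: "deterministic (core S)" and fold: "folded (core S)"
    using adm by (simp_all add: admissible_def core_def)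
  have core: "states (core S) = states ?G // ?E" "root_state (core S) = ?E `` {Root}"
    "edges (core S) = {(?E `` {p}, b, ?E `` {q}) | p b q. (p, b, q) \<in> edges ?G}"
    by (simp_all add: core_def quotient_automaton_def tree_graph_def)
  have "Root \<in> states ?G" by (simp add: tree_graph_def)
  have read: "path (core S) (root_state (core S)) w (?E `` {vertex s \<sigma> w})"
    if "s \<in> S" "w \<in> tree_words s \<sigma>" for s \<sigma> w
    using that(2)
  proof (induction w rule: rev_induct)
    case Nil
    then show ?case by (simp add: core vertex_def)
  next
    case (snoc b w)
    have "w \<in> tree_words s \<sigma>" using tree_words_prefix[OF snoc.prems, of w] by simp
    moreover have "(vertex s \<sigma> w, b, vertex s \<sigma> (w @ [b])) \<in> edges ?G"
      using snoc.prems \<open>s \<in> S\<close> by (auto simp: tree_graph_def)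
    then have "(?E `` {vertex s \<sigma> w}, b, ?E `` {vertex s \<sigma> (w @ [b])}) \<in> edges (core S)"
      unfolding core by blast
    ultimately show ?case using snoc.IH by (auto simp: path_append)
  qed
  \<comment> \<open>The leaves of the reduced diagram are the pieces, and a glued pair of leaves is
    one state of the core.\<close>
  have "piecewise (leads_to_same (core S)) s" if s: "s \<in> S" for s
    unfolding piecewise_def
  proof
    fix x
    have "s \<in> carrier thompson_F" using s S F_conj_thompson_F by blast
    then obtain us vs where d: "reduced_tree_diagram s us vs"
      using thompson_F_reduced_tree_diagram by blast
    then have "complete_prefix_code (set us)"
      by (simp add: reduced_tree_diagram_def tree_diagram_def)
    then obtain j where j: "j < length us" "x \<in> cylinder (us ! j)"
      using complete_prefix_code_cover by (metis in_set_conv_nth)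
    have len: "j < length vs" using d j by (simp add: reduced_tree_diagram_def tree_diagram_def)
    have "us ! j \<in> tree_words s T_plus" "vs ! j \<in> tree_words s T_minus"
      unfolding tree_words_def using d j len by (auto intro!: exI bexI[OF _ nth_mem])
    moreover have "(vertex s T_plus (us ! j), vertex s T_minus (vs ! j)) \<in> ?E"
    proof -
      have "(vertex s T_plus (us ! j), vertex s T_minus (vs ! j)) \<in> leaf_gluing S"
        using s d j(1) by (auto simp: leaf_gluing_def)
      then show ?thesis using adm unfolding admissible_def by blast
    qed
    then have "?E `` {vertex s T_plus (us ! j)} = ?E `` {vertex s T_minus (vs ! j)}"
      by (rule equiv_class_eq[OF equiv])
    ultimately have "leads_to_same (core S) (us ! j) (vs ! j)"
      unfolding leads_to_same_def using read[OF s] by metis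
    moreover have "replaces s (us ! j) (vs ! j)"
      using d j by (auto simp: reduced_tree_diagram_def represents_def replaces_def)
    ultimately show "\<exists>u v. x \<in> cylinder u \<and> replaces s u v \<and> leads_to_same (core S) u v"
      using j(2) by blast
  qed
  then have all: "piecewise (leads_to_same (core S)) f" if "f \<in> F_conj i" for f
    using piecewise_generate[OF det] that assms F_conj_thompson_F by blast
  \<comment> \<open>Every class lies within one class of \<open>A_kernel\<close>, so changing
    representatives along a path in the core preserves the A_i-state.\<close>
  have word: "A_equiv i (vertex_word p) w" if "path (core S) (root_state (core S)) w P" "p \<in> P"
    for w P p
    using that
  proof (induction w arbitrary: P p rule: rev_induct)
    case Nil
    then have "(Root, p) \<in> ?E" by (auto simp: core)
    then show ?case using kernel by (auto simp: A_kernel_def)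
  next
    case (snoc b w)
    then obtain Q where Q: "path (core S) (root_state (core S)) w Q" "(Q, b, P) \<in> edges (core S)"
      by (auto simp: path_append)
    then obtain q p' where e: "(q, b, p') \<in> edges ?G" "Q = ?E `` {q}" "P = ?E `` {p'}"
      by (auto simp: core)
    have "q \<in> Q" using e tree_graph.edges_closed equiv_class_self[OF equiv] by blast
    then have "A_equiv i (vertex_word q) w" using snoc.IH Q(1) by blast
    moreover have "(p', p) \<in> ?E" using snoc.prems(2) e by blast
    then have "A_equiv i (vertex_word p) (vertex_word p')" using kernel by (auto simp: A_kernel_def)
    ultimately show ?case using tree_graph_edge_word[OF e(1)] by simp
  qed
  have closed: "P \<in> states (core S) \<and> Q \<in> states (core S)" if "(P, b, Q) \<in> edges (core S)" for P b Q
    using that tree_graph.edges_closed by (auto simp: core quotient_def)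
  have nonempty: "P \<noteq> {}" if "P \<in> states (core S)" for P
    using that in_quotient_imp_non_empty[OF equiv] by (simp add: core)
  show ?thesis
  proof (rule automaton_isomorphic_A[OF det])
    show root: "root_state (core S) \<in> states (core S)"
      using \<open>Root \<in> states ?G\<close> by (auto simp: core quotient_def)
    show "\<exists>w. path (core S) (root_state (core S)) w P" if P: "P \<in> states (core S)" for P
    proof -
      obtain p where p: "P = ?E `` {p}" "p \<in> states ?G" using P by (auto simp: core elim: quotientE)
      consider "p = Root" | s \<sigma> w where "p = vertex s \<sigma> w" "s \<in> S" "w \<in> tree_words s \<sigma>"
        using p(2) by (auto simp: tree_graph_def)
      then show ?thesis
      proof cases
        case 1
        then have "path (core S) (root_state (core S)) [] P" using p by (simp add: core)
        then show ?thesis by blast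
      next
        case 2
        then show ?thesis using read p by blast
      qed
    qed
    show "\<exists>P. path (core S) (root_state (core S)) w P" for w
      using all by (rule path_exists_if_piecewise)
    show "leads_to_same (core S) u v \<longleftrightarrow> A_equiv i u v" for u v
    proof
      assume "leads_to_same (core S) u v"
      then obtain P where P: "path (core S) (root_state (core S)) u P"
        "path (core S) (root_state (core S)) v P"
        by (auto simp: leads_to_same_def)
      have "P \<in> states (core S)"
        using P(1) root closed by (cases u rule: rev_cases) (auto simp: path_append)
      \<comment> \<open>Any vertex of the common class has the A_i-state of both words.\<close>
      then obtain p where "p \<in> P" using nonempty by blast
      then show "A_equiv i u v" using P word by metis
    next
      assume "A_equiv i u v"
      then show "leads_to_same (core S) u v"
        using leads_to_same_if_F_equiv[OF det fold all] F_equiv_iff by blast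
    qed
  qed (use closed in blast)
qed

end
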